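(* Assume the balanced setting: $G$ is balanced, all weights $a_{N,n}$ are radial, and all polynomials belong to $H(a_{N,n})_0(G)$ for all $N,n$. Then the equality $AH(G)=\mathcal{V}H(G)$ holds algebraically if and only if $\mathcal{A}$ satisfies condition $(\mathrm{B})^{\sim}$.
   Context: $\mathbb{N}=\{1,2,\dots\}$. $G$ is a non-empty open subset of $\mathbb{C}^d$, $d\geq 1$; $H(G)$ is the space of holomorphic functions on $G$, and co denotes the topology of uniform convergence on compact subsets of $G$. A weight on $G$ is a strictly positive continuous function on $G$. For a weight $a$: $Ha(G)=\{f\in H(G): \|f\|_a:=\sup_{z\in G}a(z)|f(z)|<\infty\}$, a Banach space with norm $\|\cdot\|_a$, and $Ha_0(G)=\{f\in H(G): a|f| \text{ vanishes at } \infty\text{ on } G\}$, a closed subspace. ($g\colon G\to\mathbb{R}$ vanishes at $\infty$ on $G$ if for each $\varepsilon>0$ there is a compact $K\subseteq G$ with $|g(z)|<\varepsilon$ for $z\in G\setminus K$.) $\mathcal{A}=((a_{N,n})_{n\in\mathbb{N}})_{N\in\mathbb{N}}$ is a double sequence of weights on $G$ with $a_{N,n+1}\leq a_{N,n}\leq a_{N+1,n}$ for all $N,n$. $AH(G):=\operatorname{proj}_N\operatorname{ind}_nHa_{N,n}(G)$ and $\mathcal{V}H(G):=\operatorname{ind}_n\operatorname{proj}_NHa_{N,n}(G)$ (locally convex limits with inclusions as linking maps); as sets, $AH(G)=\bigcap_N\bigcup_nHa_{N,n}(G)$ and $\mathcal{V}H(G)=\bigcup_n\bigcap_NHa_{N,n}(G)\subseteq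 AH(G)$. Balanced setting: $G$ is balanced ($\lambda z\in G$ for $z\in G$, $|\lambda|\leq 1$), each weight $a$ in $\mathcal{A}$ is radial ($a(\lambda z)=a(z)$ for $|\lambda|=1$), the Banach space topologies of the spaces $Ha_{N,n}(G)$ are stronger than co, and the polynomials are contained in all the spaces $H(a_{N,n})_0(G)$. For a weight $a$, the associated weight is $\tilde a:=1/(1/a)^{\sim}$, where $(1/a)^{\sim}(z):=\sup\{|g(z)|:g\in H(G),\ |g|\leq1/a\text{ on }G\}$. Condition $(\mathrm{B})^{\sim}$: for every sequence $(n(N))_{N\in\mathbb{N}}\subseteq\mathbb{N}$ there exists $m$ such that for every $M$ there exist $L$ and $c>0$ with $\tilde a_{M,m}\leq c\,\big(\max_{N=1,\dots,L}a_{N,n(N)}\big)^{\sim}$ on $G$, where the right-hand side is $c$ times the weight associated with $\max_{N=1,\dots,L}a_{N,n(N)}$. *)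

theory Defs
  imports "HOL-Analysis.Analysis"
begin

text \<open>
  Weighted spaces of holomorphic functions on an open set \<open>G\<close> of \<open>complex ^ 'd\<close>.
  Functions and weights are total; only their values on \<open>G\<close> matter, so the spaces below contain,
  with each function, every function that agrees with it on \<open>G\<close>.
\<close>

text \<open>
  Several complex variables: the Frechet derivative exists and is complex linear.
  (\<open>has_derivative\<close> only provides real linearity.)
\<close>

definition hol_on :: "(complex ^ 'd \<Rightarrow> complex) \<Rightarrow> (complex ^ 'd) set \<Rightarrow> bool" where
  "hol_on f G \<longleftrightarrow>
     (\<forall>z\<in>G. \<exists>D. (f has_derivative D) (at z) \<and> (\<forall>c x. D (c *s x) = c * D x))"

definition weight_on :: "(complex ^ 'd) set \<Rightarrow> (complex ^ 'd \<Rightarrow> real) \<Rightarrow> bool" where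
  "weight_on G a \<longleftrightarrow> continuous_on G a \<and> (\<forall>z\<in>G. 0 < a z)"

definition balanced :: "(complex ^ 'd) set \<Rightarrow> bool" where
  "balanced G \<longleftrightarrow> (\<forall>z\<in>G. \<forall>c. cmod c \<le> 1 \<longrightarrow> c *s z \<in> G)"

definition radial_on :: "(complex ^ 'd) set \<Rightarrow> (complex ^ 'd \<Rightarrow> real) \<Rightarrow> bool" where
  "radial_on G a \<longleftrightarrow> (\<forall>z\<in>G. \<forall>c. cmod c = 1 \<longrightarrow> a (c *s z) = a z)"

definition polynomial_fun :: "(complex ^ 'd \<Rightarrow> complex) \<Rightarrow> bool" where
  "polynomial_fun p \<longleftrightarrow>
     (\<exists>(A :: ('d \<Rightarrow> nat) set) c. finite A \<and>
        p = (\<lambda>z. \<Sum>\<alpha>\<in>A. c \<alpha> * (\<Prod>i\<in>UNIV. (z $ i) ^ \<alpha> i)))"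

definition vanishes_at_infinity_on :: "(complex ^ 'd) set \<Rightarrow> (complex ^ 'd \<Rightarrow> real) \<Rightarrow> bool" where
  "vanishes_at_infinity_on G g \<longleftrightarrow>
     (\<forall>\<epsilon>>0. \<exists>K. compact K \<and> K \<subseteq> G \<and> (\<forall>z\<in>G - K. \<bar>g z\<bar> < \<epsilon>))"

definition wnorm :: "(complex ^ 'd) set \<Rightarrow> (complex ^ 'd \<Rightarrow> real) \<Rightarrow> (complex ^ 'd \<Rightarrow> complex) \<Rightarrow> real" where
  "wnorm G a f = (SUP z\<in>G. a z * cmod (f z))"

text \<open>Finiteness of the supremum is stated as \<^const>\<open>bdd_above\<close>, the real supremum being total.\<close>

definition Ha :: "(complex ^ 'd) set \<Rightarrow> (complex ^ 'd \<Rightarrow> real) \<Rightarrow> (complex ^ 'd \<Rightarrow> complex) set" where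
  "Ha G a = {f. hol_on f G \<and> bdd_above ((\<lambda>z. a z * cmod (f z)) ` G)}"

definition Ha0 :: "(complex ^ 'd) set \<Rightarrow> (complex ^ 'd \<Rightarrow> real) \<Rightarrow> (complex ^ 'd \<Rightarrow> complex) set" where
  "Ha0 G a = {f. hol_on f G \<and> vanishes_at_infinity_on G (\<lambda>z. a z * cmod (f z))}"

text \<open>
  The topology of \<^const>\<open>Ha\<close> is always finer than that of uniform convergence on compact sets, so this
  need not be assumed.
\<close>

lemma Ha_finer_than_compact_open:
  assumes "weight_on G a" "compact K" "K \<subseteq> G"
  shows "\<exists>C>0. \<forall>f\<in>Ha G a. \<forall>z\<in>K. cmod (f z) \<le> C * wnorm G a f"
proof (cases "K = {}")
  case True
  then show ?thesis by (auto intro: exI[of _ 1])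
next
  case False
  have "continuous_on K a"
    using assms by (auto simp: weight_on_def intro: continuous_on_subset)
  then obtain x where x: "x \<in> K" "\<And>z. z \<in> K \<Longrightarrow> a x \<le> a z"
    using continuous_attains_inf[OF assms(2) False] by blast
  have pos: "0 < a x" using x(1) assms by (auto simp: weight_on_def)
  have "cmod (f z) \<le> (1 / a x) * wnorm G a f" if "f \<in> Ha G a" "z \<in> K" for f z
  proof -
    have "a x * cmod (f z) \<le> a z * cmod (f z)"
      using x(2)[OF that(2)] by (simp add: mult_right_mono)
    also have "\<dots> \<le> wnorm G a f"
      unfolding wnorm_def using that assms(3) by (intro cSUP_upper) (auto simp: Ha_def)
    finally show ?thesis using pos by (simp add: field_simps)
  qed
  then show ?thesis using pos by (intro exI[of _ "1 / a x"]) auto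
qed

text \<open>\<open>assoc_growth G a\<close> is \<open>(1/a)\<^sup>~\<close>.\<close>

definition assoc_growth :: "(complex ^ 'd) set \<Rightarrow> (complex ^ 'd \<Rightarrow> real) \<Rightarrow> complex ^ 'd \<Rightarrow> real" where
  "assoc_growth G a z =
     (SUP g\<in>{g. hol_on g G \<and> (\<forall>w\<in>G. cmod (g w) \<le> 1 / a w)}. cmod (g z))"

definition assoc_weight :: "(complex ^ 'd) set \<Rightarrow> (complex ^ 'd \<Rightarrow> real) \<Rightarrow> complex ^ 'd \<Rightarrow> real" where
  "assoc_weight G a z = 1 / assoc_growth G a z"

text \<open>
  In general \<open>assoc_growth\<close> may vanish, where the associated weight should be infinite and the total
  division gives \<open>0\<close>. This cannot happen for weights that are bounded on \<open>G\<close>, in particular not if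
  the constants lie in \<open>Ha G a\<close>, nor for finite maxima of such weights.
\<close>

lemma assoc_growth_pos:
  assumes a: "weight_on G a" "bdd_above (a ` G)" and z: "z \<in> G"
  shows "0 < assoc_growth G a z"
proof -
  obtain B where B: "\<And>w. w \<in> G \<Longrightarrow> a w \<le> B"
    using a(2) by (auto simp: bdd_above_def)
  have az: "0 < a w" if "w \<in> G" for w using a(1) that by (auto simp: weight_on_def)
  have B0: "0 < B" using az[OF z] B[OF z] by linarith
  let ?S = "{g. hol_on g G \<and> (\<forall>w\<in>G. cmod (g w) \<le> 1 / a w)}"
  have "hol_on (\<lambda>_. complex_of_real (1 / B)) G"
    unfolding hol_on_def by (auto intro!: exI[of _ "\<lambda>_. 0"] derivative_eq_intros)
  moreover have "1 / B \<le> 1 / a w" if "w \<in> G" for w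
    using az[OF that] B[OF that] by (simp add: frac_le)
  ultimately have mem: "(\<lambda>_. complex_of_real (1 / B)) \<in> ?S" using B0 by (auto simp: norm_divide)
  have "bdd_above ((\<lambda>g. cmod (g z)) ` ?S)"
    using z by (auto intro!: bdd_aboveI[of _ "1 / a z"])
  from cSUP_upper[OF mem this] have "1 / B \<le> assoc_growth G a z"
    using B0 by (simp add: assoc_growth_def norm_divide)
  then show ?thesis using B0 by (smt (verit) divide_pos_pos)
qed

text \<open>
  Double sequences \<open>a N n\<close> are indexed by positive integers; values at index \<open>0\<close> are ignored.
\<close>

definition AH :: "(complex ^ 'd) set \<Rightarrow> (nat \<Rightarrow> nat \<Rightarrow> complex ^ 'd \<Rightarrow> real) \<Rightarrow> (complex ^ 'd \<Rightarrow> complex) set" where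
  "AH G a = (\<Inter>N\<in>{1..}. \<Union>n\<in>{1..}. Ha G (a N n))"

definition VH :: "(complex ^ 'd) set \<Rightarrow> (nat \<Rightarrow> nat \<Rightarrow> complex ^ 'd \<Rightarrow> real) \<Rightarrow> (complex ^ 'd \<Rightarrow> complex) set" where
  "VH G a = (\<Union>n\<in>{1..}. \<Inter>N\<in>{1..}. Ha G (a N n))"

definition condition_B_tilde :: "(complex ^ 'd) set \<Rightarrow> (nat \<Rightarrow> nat \<Rightarrow> complex ^ 'd \<Rightarrow> real) \<Rightarrow> bool" where
  "condition_B_tilde G a \<longleftrightarrow>
     (\<forall>n. (\<forall>N\<ge>1. n N \<ge> 1) \<longrightarrow>
        (\<exists>m\<ge>1. \<forall>M\<ge>1. \<exists>L\<ge>1. \<exists>c>0. \<forall>z\<in>G.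
           assoc_weight G (a M m) z
             \<le> c * assoc_weight G (\<lambda>w. MAX N\<in>{1..L}. a N (n N) w) z))"

end

theory Submission
  imports Defs "HOL-Complex_Analysis.Conformal_Mappings"
begin

text \<open>
  If \<open>(B)\<^sup>~\<close> holds and \<open>f \<in> AH(G)\<close>, choose \<open>n(N)\<close> with \<open>f \<in> Ha\<^bsub>N,n(N)\<^esub>(G)\<close>; up to a constant, \<open>f\<close> competes
  in the supremum defining the weight associated with a maximum of finitely many \<open>a\<^bsub>N,n(N)\<^esub>\<close>, so
  \<open>(B)\<^sup>~\<close> bounds \<open>a\<^bsub>M,m\<^esub> |f|\<close> for every \<open>M\<close>.

  Conversely, suppose that for some sequence \<open>n(N)\<close> and every \<open>m\<close> there is an \<open>M\<close> such that no finite
  maximum of the seminorms \<open>N, n(N)\<close> dominates the seminorm \<open>M, m\<close> on the polynomials. Then a gliding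
  hump series of polynomials lies in \<open>AH(G)\<close> but not in \<open>VH(G)\<close>. So the seminorms do dominate on
  polynomials, and since the weights are radial, Taylor polynomials of the dilations \<open>g(rz)\<close> transfer
  the estimate to all holomorphic \<open>g\<close>, which is the required inequality between associated weights.
\<close>

section \<open>Holomorphic functions of several variables\<close>

lemma norm_vector_smult_complex: "norm (c *s x) = cmod c * norm x"
  for x :: "complex ^ 'n"
  by (simp add: norm_vec_def norm_mult L2_set_right_distrib)

lemma bounded_linear_vector_smult_left: "bounded_linear (\<lambda>c. c *s v)"
  for v :: "complex ^ 'n"
  by (rule bounded_linear_intro[where K = "norm v"])
     (auto simp: vec_eq_iff algebra_simps norm_vector_smult_complex)

lemma continuous_on_vector_smult [continuous_intros]:
  fixes v :: "'a::t2_space \<Rightarrow> complex ^ 'n" and c :: "'a \<Rightarrow> complex"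
  assumes "continuous_on S c" "continuous_on S v"
  shows "continuous_on S (\<lambda>x. c x *s v x)"
  unfolding vector_scalar_mult_def
  by (intro continuous_intros assms)

text \<open>Uniqueness of derivatives identifies the witness in \<open>hol_on\<close> with
  \<open>frechet_derivative\<close>, so the derivative can be named as a function of the
  point.\<close>

lemma hol_on_has_derivative:
  assumes "hol_on f G" "z \<in> G"
  shows "(f has_derivative frechet_derivative f (at z)) (at z)"
    and "frechet_derivative f (at z) (c *s x) = c * frechet_derivative f (at z) x"
proof -
  obtain D where D: "(f has_derivative D) (at z)" "\<And>c x. D (c *s x) = c * D x"
    using assms by (auto simp: hol_on_def)
  from frechet_derivative_at[OF D(1)] have "D = frechet_derivative f (at z)" .
  with D show "(f has_derivative frechet_derivative f (at z)) (at z)"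
    and "frechet_derivative f (at z) (c *s x) = c * frechet_derivative f (at z) x"
    by auto
qed

lemma hol_on_subset: "hol_on f G \<Longrightarrow> H \<subseteq> G \<Longrightarrow> hol_on f H"
  by (auto simp: hol_on_def)

text \<open>Holomorphy is a condition at each point on the derivative \<open>at z\<close>, hence
  local; later proofs use this to work on small balls.\<close>

lemma hol_on_UN: "(\<And>z. z \<in> G \<Longrightarrow> \<exists>S. z \<in> S \<and> hol_on f S) \<Longrightarrow> hol_on f G"
  unfolding hol_on_def by blast

lemma hol_on_imp_continuous_on: "hol_on f G \<Longrightarrow> continuous_on G f"
  by (rule has_derivative_continuous_on)
     (auto intro: has_derivative_at_withinI hol_on_has_derivative(1))

lemma hol_on_cmult: "hol_on f G \<Longrightarrow> hol_on (\<lambda>z. c * f z) G"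
proof (unfold hol_on_def, intro ballI)
  fix z assume f: "\<forall>z\<in>G. \<exists>D. (f has_derivative D) (at z) \<and> (\<forall>c x. D (c *s x) = c * D x)"
    and "z \<in> G"
  then obtain D where D: "(f has_derivative D) (at z)" "\<And>c x. D (c *s x) = c * D x"
    by blast
  show "\<exists>D. ((\<lambda>z. c * f z) has_derivative D) (at z) \<and> (\<forall>c x. D (c *s x) = c * D x)"
    by (rule exI[of _ "\<lambda>h. c * D h"]) (auto intro!: derivative_eq_intros D(1) simp: D(2))
qed

lemma hol_on_diff:
  assumes "hol_on f G" "hol_on g G"
  shows "hol_on (\<lambda>z. f z - g z) G"
  unfolding hol_on_def
proof (intro ballI)
  fix z assume z: "z \<in> G"
  show "\<exists>D. ((\<lambda>z. f z - g z) has_derivative D) (at z) \<and> (\<forall>c x. D (c *s x) = c * D x)"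
    by (rule exI[of _ "\<lambda>h. frechet_derivative f (at z) h - frechet_derivative g (at z) h"])
       (use z assms in \<open>auto intro!: has_derivative_diff hol_on_has_derivative(1)
          simp: hol_on_has_derivative(2) algebra_simps\<close>)
qed

lemma hol_on_translate:
  assumes "hol_on f G" "\<And>z. z \<in> H \<Longrightarrow> z + v \<in> G"
  shows "hol_on (\<lambda>z. f (z + v)) H"
  unfolding hol_on_def
proof (intro ballI)
  fix z assume z: "z \<in> H"
  have "((\<lambda>z. f (z + v)) has_derivative (\<lambda>h. frechet_derivative f (at (z + v)) h)) (at z)"
    by (rule has_derivative_compose[where f = "\<lambda>z. z + v"])
       (use z assms in \<open>auto intro!: derivative_eq_intros hol_on_has_derivative(1)\<close>)
  then show "\<exists>D. ((\<lambda>z. f (z + v)) has_derivative D) (at z) \<and> (\<forall>c x. D (c *s x) = c * D x)"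
    using hol_on_has_derivative(2)[OF assms(1) assms(2)[OF z]] by blast
qed

section \<open>Restriction to complex lines, Cauchy estimates and uniform limits\<close>

text \<open>Chain rule along a complex line; complex linearity turns the derivative of the slice
  into multiplication by a complex number. This is the bridge to the one-variable theory.\<close>

lemma hol_on_slice_deriv:
  assumes "hol_on f G" "z + t *s v \<in> G"
  shows "((\<lambda>t. f (z + t *s v)) has_field_derivative frechet_derivative f (at (z + t *s v)) v) (at t)"
proof -
  have "((\<lambda>t. f (z + t *s v)) has_derivative
          (\<lambda>h. frechet_derivative f (at (z + t *s v)) (h *s v))) (at t)"
    by (rule has_derivative_compose[where f = "\<lambda>t. z + t *s v"])
       (use assms in \<open>auto intro!: derivative_eq_intros hol_on_has_derivative(1)
         bounded_linear.has_derivative[OF bounded_linear_vector_smult_left]\<close>)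
  then show ?thesis
    unfolding has_field_derivative_def hol_on_has_derivative(2)[OF assms]
    by (rule back_subst[of "\<lambda>D. (_ has_derivative D) _"]) auto
qed

lemma hol_on_slice:
  assumes "hol_on f G" "\<And>t. t \<in> T \<Longrightarrow> z + t *s v \<in> G"
  shows "(\<lambda>t. f (z + t *s v)) holomorphic_on T"
  unfolding holomorphic_on_def field_differentiable_def
  using hol_on_slice_deriv[OF assms(1)] assms(2) DERIV_subset by blast

text \<open>The one-variable Cauchy inequality for the slice through \<open>z\<close> in direction
  \<open>h\<close>, whose derivative at 0 is the derivative of \<open>f\<close> at \<open>z\<close>
  applied to \<open>h\<close>.\<close>

lemma Cauchy_estimate_hol_on:
  assumes f: "hol_on f G" and "0 < r" "cball z r \<subseteq> G"
    and B: "\<And>w. w \<in> cball z r \<Longrightarrow> cmod (f w) \<le> B"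
  shows "cmod (frechet_derivative f (at z) h) \<le> B / r * norm h"
proof (cases "h = 0")
  case True
  have "z \<in> G" using assms(2,3) by auto
  with f have "linear (frechet_derivative f (at z))"
    by (rule has_derivative_linear[OF hol_on_has_derivative(1)])
  with True show ?thesis by (simp add: linear_0)
next
  case False
  \<comment> \<open>The largest radius for which the disc in direction \<open>h\<close> stays in
    \<open>cball z r\<close>; dividing \<open>B\<close> by it produces
    \<open>B / r * norm h\<close>.\<close>
  define s where "s = r / norm h"
  have s: "0 < s" using False assms by (simp add: s_def)
  have in_ball: "z + t *s h \<in> cball z r" if "cmod t \<le> s" for t
    using that False by (simp add: dist_norm norm_vector_smult_complex s_def field_simps)
  have hol: "(\<lambda>t. f (z + t *s h)) holomorphic_on cball 0 s"
    by (rule hol_on_slice[OF f]) (use in_ball assms(3) in auto)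
  have "cmod ((deriv ^^ 1) (\<lambda>t. f (z + t *s h)) 0) \<le> fact 1 * B / s ^ 1"
    by (rule Cauchy_inequality)
       (use hol s in \<open>auto intro: holomorphic_on_subset holomorphic_on_imp_continuous_on B in_ball\<close>)
  moreover have "deriv (\<lambda>t. f (z + t *s h)) 0 = frechet_derivative f (at z) h"
    using hol_on_slice_deriv[OF f, of z 0 h] assms(2,3)
    by (intro DERIV_imp_deriv) (auto simp: subset_iff)
  ultimately show ?thesis by (simp add: s_def)
qed

text \<open>Weierstrass's theorem: Cauchy estimates on balls of a fixed radius turn uniform
  convergence of the functions into uniform convergence of their derivatives, and complex linearity
  survives the pointwise limit.\<close>

lemma hol_on_uniform_limit:
  assumes S: "open S" and f: "\<And>n. hol_on (f n) S"
    and lim: "uniform_limit S f g sequentially"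
  shows "hol_on g S"
  unfolding hol_on_def
proof (intro ballI)
  fix z assume z: "z \<in> S"
  obtain \<rho> where \<rho>: "0 < \<rho>" "cball z \<rho> \<subseteq> S"
    using S z open_contains_cball by blast
  \<comment> \<open>Halving leaves room for a closed ball of radius \<open>r\<close> around every
    point of \<open>K\<close>.\<close>
  define r where "r = \<rho> / 2"
  define K where "K = ball z r"
  have r: "0 < r" using \<rho> by (simp add: r_def)
  have zK: "z \<in> K" and KS: "K \<subseteq> S" using r \<rho> by (auto simp: K_def r_def)
  have cb: "cball x r \<subseteq> S" if "x \<in> K" for x
  proof
    fix y assume "y \<in> cball x r"
    then have "dist z y \<le> \<rho>"
      using that dist_triangle[of z y x] by (auto simp: K_def r_def)
    then show "y \<in> S" using \<rho> by auto
  qed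
  define F where "F n x = frechet_derivative (f n) (at x)" for n x
  have F: "(f n has_derivative F n x) (at x)" "F n x (c *s h) = c * F n x h"
    if "x \<in> K" for n x c h
    using hol_on_has_derivative[OF f, of x n] that KS by (auto simp: F_def)
  have cauchy: "\<exists>n0. \<forall>m\<ge>n0. \<forall>n\<ge>n0. \<forall>x\<in>K. \<forall>h. cmod (F n x h - F m x h) \<le> e * norm h"
    if "0 < e" for e
  proof -
    \<comment> \<open>Two errors of this size add up to \<open>e * r\<close>, and the Cauchy
      estimate divides by \<open>r\<close>.\<close>
    have "0 < e * r / 2" using that r by simp
    from lim[unfolded uniform_limit_sequentially_iff, rule_format, OF this] obtain n0
      where n0: "\<And>n x. n \<ge> n0 \<Longrightarrow> x \<in> S \<Longrightarrow> dist (f n x) (g x) < e * r / 2" by blast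
    have "cmod (F n x h - F m x h) \<le> e * norm h" if mn: "m \<ge> n0" "n \<ge> n0" and x: "x \<in> K" for m n x h
    proof -
      have "cmod (f n w - f m w) \<le> e * r" if "w \<in> cball x r" for w
      proof -
        have w: "w \<in> S" using cb[OF x] that by auto
        show ?thesis
          using n0[OF mn(1) w] n0[OF mn(2) w] dist_triangle2[of "f n w" "f m w" "g w"]
          by (simp add: dist_norm)
      qed
      from Cauchy_estimate_hol_on[OF hol_on_diff[OF f f] r cb[OF x] this]
      have "cmod (frechet_derivative (\<lambda>w. f n w - f m w) (at x) h) \<le> e * norm h"
        using r by simp
      moreover have "(\<lambda>h. F n x h - F m x h) = frechet_derivative (\<lambda>w. f n w - f m w) (at x)"
        using F(1)[OF x] by (intro frechet_derivative_at has_derivative_diff)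
      ultimately show ?thesis by metis
    qed
    then show ?thesis by blast
  qed
  define g' where "g' x h = lim (\<lambda>n. F n x h)" for x h
  have F_lim: "(\<lambda>n. F n x h) \<longlonglongrightarrow> g' x h" if "x \<in> K" for x h
  proof -
    have "Cauchy (\<lambda>n. F n x h)"
    proof (rule CauchyI)
      fix e :: real assume e: "0 < e"
      \<comment> \<open>Adding 1 covers \<open>h = 0\<close> and makes the resulting bound strictly
        smaller than \<open>e\<close>.\<close>
      then have "0 < e / (norm h + 1)" by (simp add: add_nonneg_pos)
      from cauchy[OF this] that obtain n0 where
        n0: "\<forall>m\<ge>n0. \<forall>n\<ge>n0. cmod (F n x h - F m x h) \<le> e / (norm h + 1) * norm h"
        by metis
      moreover have "e / (norm h + 1) * norm h < e"
        using e by (simp add: pos_divide_less_eq add_nonneg_pos distrib_left)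
      ultimately show "\<exists>M. \<forall>m\<ge>M. \<forall>n\<ge>M. cmod (F m x h - F n x h) < e"
        by (meson le_less_trans)
    qed
    then show ?thesis
      by (simp add: g'_def Cauchy_convergent convergent_LIMSEQ_iff[symmetric])
  qed
  have unif: "\<forall>\<^sub>F n in sequentially. \<forall>x\<in>K. \<forall>h. cmod (F n x h - g' x h) \<le> e * norm h"
    if e: "0 < e" for e
  proof -
    obtain n0 where
      n0: "\<And>m n x h. m \<ge> n0 \<Longrightarrow> n \<ge> n0 \<Longrightarrow> x \<in> K \<Longrightarrow> cmod (F n x h - F m x h) \<le> e * norm h"
      using cauchy[OF e] by blast
    have "cmod (F n x h - g' x h) \<le> e * norm h" if "n \<ge> n0" "x \<in> K" for n x h
    proof (rule Lim_bounded)
      show "(\<lambda>m. cmod (F n x h - F m x h)) \<longlonglongrightarrow> cmod (F n x h - g' x h)"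
        by (intro tendsto_intros F_lim that)
      show "\<forall>m\<ge>n0. cmod (F n x h - F m x h) \<le> e * norm h" using n0 that by blast
    qed
    then show ?thesis unfolding eventually_sequentially by blast
  qed
  have pt: "(\<lambda>n. f n x) \<longlonglongrightarrow> g x" if "x \<in> K" for x
    using tendsto_uniform_limitI[OF lim] that KS by blast
  have "\<exists>g2. \<forall>x\<in>K. (\<lambda>n. f n x) \<longlonglongrightarrow> g2 x \<and> (g2 has_derivative g' x) (at x within K)"
    by (rule has_derivative_sequence[where f' = F and ?x0.0 = z and l = "g z"])
       (use F(1) unif zK pt in \<open>auto simp: K_def intro: has_derivative_at_withinI\<close>)
  then obtain g2 where g2: "\<And>x. x \<in> K \<Longrightarrow> (\<lambda>n. f n x) \<longlonglongrightarrow> g2 x"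
    "\<And>x. x \<in> K \<Longrightarrow> (g2 has_derivative g' x) (at x within K)" by blast
  have eq: "g2 x = g x" if "x \<in> K" for x
    using LIMSEQ_unique g2(1) pt that by blast
  have "(g has_derivative g' z) (at z)"
  proof (rule has_derivative_transform_within_open[of g2 _ _ _ K])
    show "(g2 has_derivative g' z) (at z)"
      using g2(2)[OF zK] zK at_within_open[of z K] by (simp add: K_def)
  qed (use zK eq in \<open>auto simp: K_def\<close>)
  moreover have "g' z (c *s h) = c * g' z h" for c h
  proof (rule LIMSEQ_unique[OF F_lim[OF zK]])
    show "(\<lambda>n. F n z (c *s h)) \<longlonglongrightarrow> c * g' z h"
      unfolding F(2)[OF zK] by (intro tendsto_intros F_lim zK)
  qed
  ultimately show "\<exists>D. (g has_derivative D) (at z) \<and> (\<forall>c x. D (c *s x) = c * D x)" by blast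
qed

section \<open>Directional derivatives as limits of difference quotients\<close>

text \<open>Taylor's theorem of order one: on \<open>cball 0 \<tau>\<close> the second derivative is
  controlled by Cauchy's inequality on discs of radius \<open>\<tau>\<close>, which stay inside
  \<open>cball 0 (2 * \<tau>)\<close>.\<close>

lemma complex_difference_quotient_bound:
  assumes \<phi>: "\<phi> holomorphic_on cball 0 (2 * \<tau>)" and \<tau>: "0 < \<tau>"
    and B: "\<And>t. cmod t \<le> 2 * \<tau> \<Longrightarrow> cmod (\<phi> t) \<le> B"
    and h: "cmod h \<le> \<tau>"
  shows "cmod (\<phi> h - \<phi> 0 - h * deriv \<phi> 0) \<le> 2 * B / \<tau>\<^sup>2 * (cmod h)\<^sup>2"
proof -
  have hol: "\<phi> holomorphic_on ball 0 (2 * \<tau>)"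
    by (rule holomorphic_on_subset[OF \<phi>]) auto
  have bd: "cmod ((deriv ^^ Suc 1) \<phi> x) \<le> 2 * B / \<tau>\<^sup>2" if "x \<in> cball 0 \<tau>" for x
  proof -
    have sub: "cball x \<tau> \<subseteq> cball 0 (2 * \<tau>)"
    proof
      fix y assume "y \<in> cball x \<tau>"
      then show "y \<in> cball 0 (2 * \<tau>)"
        using that norm_triangle_sub[of y x] by (auto simp: dist_norm norm_minus_commute)
    qed
    have hx: "\<phi> holomorphic_on cball x \<tau>" by (rule holomorphic_on_subset[OF \<phi> sub])
    have "cmod ((deriv ^^ Suc 1) \<phi> x) \<le> fact (Suc 1) * B / \<tau> ^ Suc 1"
    proof (rule Cauchy_inequality)
      show "cmod (\<phi> y) \<le> B" if "cmod (x - y) = \<tau>" for y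
      proof -
        have "y \<in> cball x \<tau>" using that by (simp add: dist_norm)
        with sub have "cmod y \<le> 2 * \<tau>" by (auto dest!: subsetD)
        then show ?thesis by (rule B)
      qed
    qed (use hx \<tau> in \<open>auto intro: holomorphic_on_subset holomorphic_on_imp_continuous_on\<close>)
    then show ?thesis by (simp add: numeral_2_eq_2)
  qed
  have der: "((deriv ^^ i) \<phi> has_field_derivative (deriv ^^ Suc i) \<phi> x) (at x within cball 0 \<tau>)"
    if "x \<in> cball 0 \<tau>" for i x
  proof -
    have "(deriv ^^ i) \<phi> holomorphic_on ball 0 (2 * \<tau>)"
      by (rule holomorphic_higher_deriv[OF hol]) simp
    moreover have "x \<in> ball 0 (2 * \<tau>)" using that \<tau> by simp
    ultimately show ?thesis
      by (simp add: holomorphic_derivI[of _ "ball 0 (2 * \<tau>)"])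
  qed
  have "cmod ((deriv ^^ 0) \<phi> h - (\<Sum>i\<le>1. (deriv ^^ i) \<phi> 0 * (h - 0) ^ i / fact i))
      \<le> 2 * B / \<tau>\<^sup>2 * cmod (h - 0) ^ Suc 1 / fact 1"
    by (rule complex_Taylor[where S = "cball 0 \<tau>" and f = "\<lambda>i. (deriv ^^ i) \<phi>"])
       (use der bd h \<tau> in auto)
  then show ?thesis by (simp add: algebra_simps numeral_2_eq_2)
qed

text \<open>Near each point the directional derivative is a uniform limit of difference quotients, which
  are holomorphic; this avoids any appeal to the iterated Cauchy integral formula.\<close>

lemma hol_on_directional_derivative:
  assumes G: "open G" and g: "hol_on g G"
  shows "hol_on (\<lambda>z. frechet_derivative g (at z) v) G"
proof (rule hol_on_UN)
  fix z0 assume z0: "z0 \<in> G"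
  obtain R where R: "0 < R" "cball z0 R \<subseteq> G"
    using G z0 open_contains_cball by blast
  \<comment> \<open>One third is for the base point and two thirds are for displacements
    \<open>t *s v\<close> with \<open>cmod t \<le> 2 * \<tau>\<close>.\<close>
  define \<rho> where "\<rho> = R / 3"
  have \<rho>: "0 < \<rho>" using R by (simp add: \<rho>_def)
  define \<tau> where "\<tau> = \<rho> / (norm v + 1)"
  have \<tau>: "0 < \<tau>" using \<rho> by (simp add: \<tau>_def add_nonneg_pos)
  have \<tau>v: "\<tau> * norm v \<le> \<rho>"
    using \<rho> by (simp add: \<tau>_def pos_divide_le_eq add_nonneg_pos distrib_left)
  have in_ball: "z + t *s v \<in> cball z0 R" if "z \<in> ball z0 \<rho>" "cmod t \<le> 2 * \<tau>" for z t
  proof -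
    have "norm (t *s v) \<le> 2 * \<tau> * norm v"
      unfolding norm_vector_smult_complex by (intro mult_right_mono that) auto
    also have "\<dots> \<le> 2 * \<rho>" using \<tau>v by simp
    finally have "norm (t *s v) \<le> 2 * \<rho>" .
    moreover have "norm (z0 - (z + t *s v)) \<le> norm (z0 - z) + norm (t *s v)"
      by (metis diff_diff_add norm_triangle_ineq4)
    moreover have "norm (z0 - z) < \<rho>" using that by (simp add: dist_norm)
    ultimately show ?thesis by (simp add: \<rho>_def dist_norm)
  qed
  have "compact (g ` cball z0 R)"
    using hol_on_imp_continuous_on[OF g] R(2)
    by (intro compact_continuous_image) (auto intro: continuous_on_subset)
  then obtain B where B: "\<And>w. w \<in> cball z0 R \<Longrightarrow> cmod (g w) \<le> B"
    using bounded_iff[of "g ` cball z0 R"] compact_imp_bounded by fastforce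
  have B0: "0 \<le> B" using B[of z0] R(1) norm_ge_zero[of "g z0"] by (simp del: norm_ge_zero)
  define h where "h n = \<tau> / real (Suc n)" for n
  have h: "0 < h n" "h n \<le> \<tau>" for n
    using \<tau> by (auto simp: h_def divide_simps)
  \<comment> \<open>The summand \<open>+ 0\<close> gives both terms the shape of a translate, so
    that \<open>hol_on_translate\<close> applies to each.\<close>
  define q where "q n z = (1 / of_real (h n)) * (g (z + of_real (h n) *s v) - g (z + 0))" for n z
  have q_hol: "hol_on (q n) (ball z0 \<rho>)" for n
    unfolding q_def
  proof (intro hol_on_cmult hol_on_diff hol_on_translate[OF g])
    fix z assume z: "z \<in> ball z0 \<rho>"
    have "z + 0 *s v \<in> cball z0 R" using z \<tau> by (intro in_ball) auto
    then show "z + 0 \<in> G" using R(2) by auto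
    have "z + of_real (h n) *s v \<in> cball z0 R" using z h(1)[of n] h(2)[of n] \<tau> by (intro in_ball) auto
    then show "z + of_real (h n) *s v \<in> G" using R(2) by auto
  qed
  \<comment> \<open>The remainder is quadratic in \<open>h n\<close>; division by \<open>h n\<close>
    leaves a linear error that is uniform on the ball.\<close>
  have q_bd: "dist (q n z) (frechet_derivative g (at z) v) \<le> 2 * B / \<tau>\<^sup>2 * h n"
    if z: "z \<in> ball z0 \<rho>" for n z
  proof -
    define \<phi> where "\<phi> t = g (z + t *s v)" for t
    have zG: "z \<in> G" using in_ball[OF z, of 0] \<tau> R(2) by auto
    have d: "deriv \<phi> 0 = frechet_derivative g (at z) v"
      using hol_on_slice_deriv[OF g, of z 0 v] zG unfolding \<phi>_def
      by (intro DERIV_imp_deriv) simp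
    have hol: "\<phi> holomorphic_on cball 0 (2 * \<tau>)"
      unfolding \<phi>_def by (rule hol_on_slice[OF g]) (use in_ball[OF z] R(2) in auto)
    have *: "cmod (\<phi> (h n) - \<phi> 0 - h n * deriv \<phi> 0) \<le> 2 * B / \<tau>\<^sup>2 * (cmod (h n))\<^sup>2"
      by (rule complex_difference_quotient_bound[OF hol \<tau>])
         (use B in_ball[OF z] h[of n] in \<open>auto simp: \<phi>_def\<close>)
    have "q n z - frechet_derivative g (at z) v = (\<phi> (h n) - \<phi> 0 - h n * deriv \<phi> 0) / h n"
      using h(1)[of n] by (simp add: q_def d \<phi>_def field_simps)
    then have "dist (q n z) (frechet_derivative g (at z) v) =
        cmod (\<phi> (h n) - \<phi> 0 - h n * deriv \<phi> 0) / h n"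
      using h(1)[of n] by (simp add: dist_norm norm_divide)
    also have "\<dots> \<le> 2 * B / \<tau>\<^sup>2 * (cmod (h n))\<^sup>2 / h n"
      using h(1)[of n] by (intro divide_right_mono *) auto
    also have "\<dots> = 2 * B / \<tau>\<^sup>2 * h n"
      using h(1)[of n] by (simp add: power2_eq_square)
    finally show ?thesis .
  qed
  have h0: "(\<lambda>n. 2 * B / \<tau>\<^sup>2 * h n) \<longlonglongrightarrow> 0"
    unfolding h_def
    using tendsto_mult[OF tendsto_const[of "2 * B / \<tau>\<^sup>2"] LIMSEQ_Suc[OF lim_const_over_n[of \<tau>]]]
    by (simp only: mult_zero_right)
  have "uniform_limit (ball z0 \<rho>) q (\<lambda>z. frechet_derivative g (at z) v) sequentially"
  proof (rule uniform_limitI)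
    fix e :: real assume "0 < e"
    with h0 have "\<forall>\<^sub>F n in sequentially. 2 * B / \<tau>\<^sup>2 * h n < e"
      by (rule order_tendstoD)
    then show "\<forall>\<^sub>F n in sequentially. \<forall>z\<in>ball z0 \<rho>. dist (q n z) (frechet_derivative g (at z) v) < e"
      by (rule eventually_mono) (use q_bd in \<open>blast intro: le_less_trans\<close>)
  qed
  then have "hol_on (\<lambda>z. frechet_derivative g (at z) v) (ball z0 \<rho>)"
    by (rule hol_on_uniform_limit[OF open_ball q_hol])
  then show "\<exists>S. z0 \<in> S \<and> hol_on (\<lambda>z. frechet_derivative g (at z) v) S"
    using \<rho> by (intro exI[of _ "ball z0 \<rho>"]) auto
qed

section \<open>Polynomial functions and radial Taylor coefficients\<close>

lemma polynomial_fun_const: "polynomial_fun (\<lambda>_. k)"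
  unfolding polynomial_fun_def
  by (intro exI[of _ "{\<lambda>_. 0}"] exI[of _ "\<lambda>_. k"]) simp

lemma polynomial_fun_cmult:
  assumes "polynomial_fun p"
  shows "polynomial_fun (\<lambda>z. k * p z)"
proof -
  obtain A c where "finite A" "p = (\<lambda>z. \<Sum>\<alpha>\<in>A. c \<alpha> * (\<Prod>i\<in>UNIV. (z $ i) ^ \<alpha> i))"
    using assms by (auto simp: polynomial_fun_def)
  then show ?thesis unfolding polynomial_fun_def
    by (intro exI[of _ A] exI[of _ "\<lambda>\<alpha>. k * c \<alpha>"]) (simp add: sum_distrib_left mult.assoc)
qed

lemma polynomial_fun_add:
  assumes "polynomial_fun p" "polynomial_fun q"
  shows "polynomial_fun (\<lambda>z. p z + q z)"
proof -
  define m where "m \<alpha> z = (\<Prod>i\<in>UNIV. (z $ i) ^ \<alpha> i)" for \<alpha> and z :: "complex ^ 'a"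
  obtain A c where A: "finite A" "p = (\<lambda>z. \<Sum>\<alpha>\<in>A. c \<alpha> * m \<alpha> z)"
    using assms(1) by (auto simp: polynomial_fun_def m_def)
  obtain B d where B: "finite B" "q = (\<lambda>z. \<Sum>\<alpha>\<in>B. d \<alpha> * m \<alpha> z)"
    using assms(2) by (auto simp: polynomial_fun_def m_def)
  \<comment> \<open>Padding the coefficients with zeros lets both sums run over the same set of
    exponents.\<close>
  define e where "e \<alpha> = (if \<alpha> \<in> A then c \<alpha> else 0) + (if \<alpha> \<in> B then d \<alpha> else 0)" for \<alpha>
  have "(\<Sum>\<alpha>\<in>A \<union> B. e \<alpha> * m \<alpha> z) = p z + q z" for z
  proof -
    have "(\<Sum>\<alpha>\<in>A \<union> B. e \<alpha> * m \<alpha> z) =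
        (\<Sum>\<alpha>\<in>A \<union> B. if \<alpha> \<in> A then c \<alpha> * m \<alpha> z else 0) +
        (\<Sum>\<alpha>\<in>A \<union> B. if \<alpha> \<in> B then d \<alpha> * m \<alpha> z else 0)"
      unfolding sum.distrib[symmetric] by (rule sum.cong) (auto simp: e_def algebra_simps)
    also have "\<dots> = p z + q z"
      using A B by (simp add: sum.inter_restrict[symmetric] Int_absorb1)
    finally show ?thesis .
  qed
  then have "(\<lambda>z. p z + q z) = (\<lambda>z. \<Sum>\<alpha>\<in>A \<union> B. e \<alpha> * m \<alpha> z)" by simp
  then show ?thesis
    unfolding polynomial_fun_def m_def using A(1) B(1)
    by (intro exI[of _ "A \<union> B"] exI[of _ e]) simp
qed

lemma polynomial_fun_sum:
  "finite I \<Longrightarrow> (\<And>i. i \<in> I \<Longrightarrow> polynomial_fun (p i)) \<Longrightarrow> polynomial_fun (\<lambda>z. \<Sum>i\<in>I. p i z)"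
  by (induction I rule: finite_induct)
     (auto intro: polynomial_fun_add simp: polynomial_fun_const)

lemma polynomial_fun_coordinate_mult:
  assumes "polynomial_fun p"
  shows "polynomial_fun (\<lambda>z. z $ i * p z)"
proof -
  obtain A c where A: "finite A" "p = (\<lambda>z. \<Sum>\<alpha>\<in>A. c \<alpha> * (\<Prod>i\<in>UNIV. (z $ i) ^ \<alpha> i))"
    using assms by (auto simp: polynomial_fun_def)
  \<comment> \<open>Multiplication by the coordinate raises one exponent. This shift is injective,
    so the coefficients can be relabelled by \<open>the_inv s\<close>.\<close>
  define s where "s \<alpha> = \<alpha>(i := Suc (\<alpha> i))" for \<alpha>
  have inj: "inj s" by (auto simp: inj_def s_def fun_eq_iff split: if_splits)
  have mon: "(\<Prod>j\<in>UNIV. (z $ j) ^ s \<alpha> j) = z $ i * (\<Prod>j\<in>UNIV. (z $ j) ^ \<alpha> j)"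
    for \<alpha> and z :: "complex ^ 'a"
  proof -
    have "(\<Prod>j\<in>UNIV. (z $ j) ^ s \<alpha> j) = (\<Prod>j\<in>UNIV. (if j = i then z $ i else 1) * (z $ j) ^ \<alpha> j)"
      by (rule prod.cong) (auto simp: s_def)
    also have "\<dots> = z $ i * (\<Prod>j\<in>UNIV. (z $ j) ^ \<alpha> j)"
      by (simp add: prod.distrib)
    finally show ?thesis .
  qed
  show ?thesis
    unfolding polynomial_fun_def
    by (intro exI[of _ "s ` A"] exI[of _ "c \<circ> the_inv s"])
       (use A inj in \<open>auto simp: sum.reindex inj_on_subset mon sum_distrib_left the_inv_f_f
          mult.left_commute fun_eq_iff intro!: sum.cong\<close>)
qed

text \<open>Serves the expansion of radial derivatives below, where the coefficients are the
  coordinates of a fixed vector and hence constant in \<open>t\<close>.\<close>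

lemma higher_deriv_cmult_sum_at:
  assumes "finite I" "\<And>i. i \<in> I \<Longrightarrow> f i analytic_on {z}"
  shows "(deriv ^^ n) (\<lambda>t. \<Sum>i\<in>I. c i * f i t) z = (\<Sum>i\<in>I. c i * (deriv ^^ n) (f i) z)"
  using assms
proof (induction I rule: finite_induct)
  case empty
  then show ?case by (induction n) (simp_all add: funpow_swap1 del: funpow.simps(2))
next
  case (insert j I)
  have "(deriv ^^ n) (\<lambda>t. \<Sum>i\<in>insert j I. c i * f i t) z =
        (deriv ^^ n) (\<lambda>t. c j * f j t + (\<Sum>i\<in>I. c i * f i t)) z"
    using insert by simp
  also have "\<dots> = (deriv ^^ n) (\<lambda>t. c j * f j t) z + (deriv ^^ n) (\<lambda>t. \<Sum>i\<in>I. c i * f i t) z"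
    using insert.prems by (intro higher_deriv_add_at analytic_intros) auto
  also have "\<dots> = c j * (deriv ^^ n) (f j) z + (\<Sum>i\<in>I. c i * (deriv ^^ n) (f i) z)"
    using insert by (simp add: higher_deriv_cmult')
  finally show ?case using insert by simp
qed

text \<open>Differentiating \<open>g (t z)\<close> in \<open>t\<close> gives \<open>\<Sum>i. z\<^sub>i \<partial>\<^sub>i g (t z)\<close>, so induction on \<open>k\<close>
  applies to the partial derivatives of \<open>g\<close>.\<close>

lemma polynomial_fun_radial_derivative:
  assumes G: "open G" "0 \<in> G" and "hol_on g G"
  shows "polynomial_fun (\<lambda>z. (deriv ^^ k) (\<lambda>t. g (t *s z)) 0)"
  using \<open>hol_on g G\<close>
proof (induction k arbitrary: g)
  case 0
  then show ?case by (simp add: polynomial_fun_const)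
next
  case (Suc k)
  define dg where "dg i w = frechet_derivative g (at w) (axis i 1)" for i w
  have dg: "hol_on (dg i) G" for i
    unfolding dg_def by (rule hol_on_directional_derivative[OF G(1) Suc.prems])
  have eq: "(deriv ^^ Suc k) (\<lambda>t. g (t *s z)) 0 =
      (\<Sum>i\<in>UNIV. z $ i * (deriv ^^ k) (\<lambda>t. dg i (t *s z)) 0)" for z
  proof -
    \<comment> \<open>Equality on this open neighbourhood of 0 suffices for equality of all higher
      derivatives at 0.\<close>
    define T where "T = (\<lambda>t. t *s z) -` G"
    have T: "open T" "0 \<in> T"
      unfolding T_def using G by (auto intro!: open_vimage continuous_intros)
    have d: "deriv (\<lambda>t. g (t *s z)) t = (\<Sum>i\<in>UNIV. z $ i * dg i (t *s z))" if "t \<in> T" for t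
    proof -
      have tG: "t *s z \<in> G" using that by (simp add: T_def)
      have "deriv (\<lambda>t. g (t *s z)) t = frechet_derivative g (at (t *s z)) z"
        using hol_on_slice_deriv[OF Suc.prems, of 0 t z] tG by (intro DERIV_imp_deriv) simp
      \<comment> \<open>Expanding the direction in the standard basis brings in the partial
        derivatives by linearity.\<close>
      also have "\<dots> = frechet_derivative g (at (t *s z)) (\<Sum>i\<in>UNIV. z $ i *s axis i 1)"
        by (simp add: basis_expansion)
      also have "\<dots> = (\<Sum>i\<in>UNIV. z $ i * dg i (t *s z))"
        using has_derivative_linear[OF hol_on_has_derivative(1)[OF Suc.prems tG]]
        by (simp add: linear_sum hol_on_has_derivative(2)[OF Suc.prems tG] dg_def)
      finally show ?thesis .
    qed
    have hol: "(\<lambda>t. dg i (t *s z)) holomorphic_on T" for i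
      using hol_on_slice[OF dg, of T 0 z i] by (simp add: T_def)
    have "(deriv ^^ Suc k) (\<lambda>t. g (t *s z)) 0 = (deriv ^^ k) (deriv (\<lambda>t. g (t *s z))) 0"
      by (simp add: funpow_swap1)
    also have "\<dots> = (deriv ^^ k) (\<lambda>t. \<Sum>i\<in>UNIV. z $ i * dg i (t *s z)) 0"
    proof (rule higher_deriv_transform_within_open[OF _ _ T])
      show "deriv (\<lambda>t. g (t *s z)) holomorphic_on T"
        using hol_on_slice[OF Suc.prems, of T 0 z] T(1)
        by (intro holomorphic_deriv) (auto simp: T_def)
      show "(\<lambda>t. \<Sum>i\<in>UNIV. z $ i * dg i (t *s z)) holomorphic_on T"
        by (intro holomorphic_intros hol)
    qed (rule d)
    also have "\<dots> = (\<Sum>i\<in>UNIV. z $ i * (deriv ^^ k) (\<lambda>t. dg i (t *s z)) 0)"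
      using hol T by (intro higher_deriv_cmult_sum_at) (auto simp: analytic_at)
    finally show ?thesis .
  qed
  show ?case
    unfolding eq by (intro polynomial_fun_sum polynomial_fun_coordinate_mult Suc.IH dg) simp
qed

section \<open>Polynomials in weighted spaces\<close>

text \<open>The tail is dominated by a geometric series. The factor \<open>r ^ n / (1 - r)\<close>
  is independent of the coefficients, so one degree will serve all points of
  \<open>G\<close>.\<close>

lemma power_series_partial_sum_bound:
  fixes c :: "nat \<Rightarrow> complex"
  assumes "\<And>k. cmod (c k) \<le> B" "0 \<le> r" "r < 1"
    and "(\<lambda>k. c k * of_real r ^ k) sums s"
  shows "cmod (s - (\<Sum>k<n. c k * of_real r ^ k)) \<le> B * (r ^ n / (1 - r))"
proof -
  have geom: "(\<lambda>k. B * r ^ n * r ^ k) sums (B * r ^ n * (1 / (1 - r)))"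
    using assms by (intro sums_mult geometric_sums) auto
  have "(\<lambda>k. c (k + n) * of_real r ^ (k + n)) sums (s - (\<Sum>k<n. c k * of_real r ^ k))"
    by (rule sums_split_initial_segment[OF assms(4)])
  then have "cmod (s - (\<Sum>k<n. c k * of_real r ^ k)) =
      cmod (\<Sum>k. c (k + n) * of_real r ^ (k + n))"
    by (simp add: sums_iff)
  also have "\<dots> \<le> (\<Sum>k. B * r ^ n * r ^ k)"
  proof (rule norm_suminf_le)
    show "cmod (c (k + n) * of_real r ^ (k + n)) \<le> B * r ^ n * r ^ k" for k
      using mult_right_mono[OF assms(1)[of "k + n"], of "r ^ (k + n)"] assms(2)
      by (simp add: norm_mult norm_power power_add ac_simps)
  qed (use geom in \<open>simp add: sums_iff\<close>)
  also have "\<dots> = B * (r ^ n / (1 - r))" using geom by (simp add: sums_iff)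
  finally show ?thesis .
qed

text \<open>Openness allows \<open>z\<close> to be enlarged slightly to \<open>R *s z\<close>, and
  balancedness fills in the disc below it. Since \<open>R > 1\<close>, the closed unit disc lies
  inside the domain of the slice.\<close>

lemma balanced_slice_holomorphic:
  assumes G: "open G" "balanced G" and g: "hol_on g G" and z: "z \<in> G"
  obtains R where "1 < R" "(\<lambda>t. g (t *s z)) holomorphic_on ball 0 R"
proof -
  have "open ((\<lambda>t :: complex. t *s z) -` G)"
    using G(1) by (auto intro!: open_vimage continuous_intros)
  moreover have "1 \<in> (\<lambda>t :: complex. t *s z) -` G" using z by simp
  ultimately obtain e where e: "0 < e" "ball 1 e \<subseteq> (\<lambda>t :: complex. t *s z) -` G"
    by (meson openE)
  define R where "R = 1 + e / 2"
  have R: "1 < R" using e by (simp add: R_def)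
  have "of_real R \<in> ball (1 :: complex) e"
    using e by (simp add: R_def dist_norm norm_divide)
  with e have Rz: "complex_of_real R *s z \<in> G" by blast
  have "t *s z \<in> G" if "t \<in> ball 0 R" for t
  proof -
    have "cmod (t / of_real R) \<le> 1" using that R by (simp add: norm_divide)
    with G(2) Rz have "(t / of_real R) *s (complex_of_real R *s z) \<in> G"
      unfolding balanced_def by blast
    moreover have "t / of_real R * complex_of_real R = t" using R by simp
    ultimately show ?thesis by (simp only: vector_smult_assoc)
  qed
  then have "(\<lambda>t. g (0 + t *s z)) holomorphic_on ball 0 R"
    by (intro hol_on_slice[OF g]) simp
  with R show ?thesis by (intro that) simp_all
qed

text \<open>A function in the unit ball is approximated by the Taylor polynomials of its dilations, which
  lie in twice that ball: radiality bounds the Taylor coefficients of each slice and, by the maximum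
  principle, the dilations.\<close>

lemma weighted_polynomial_bound_extends:
  fixes u b :: "complex ^ 'd \<Rightarrow> real"
  assumes G: "open G" "balanced G" and g: "hol_on g G"
    and u: "\<And>z. z \<in> G \<Longrightarrow> 0 < u z" "radial_on G u"
    and ug: "\<And>z. z \<in> G \<Longrightarrow> u z * cmod (g z) \<le> 1"
    and b: "\<And>z. z \<in> G \<Longrightarrow> 0 \<le> b z"
    and poly: "\<And>p z. polynomial_fun p \<Longrightarrow> (\<And>w. w \<in> G \<Longrightarrow> u w * cmod (p w) \<le> 1) \<Longrightarrow> z \<in> G \<Longrightarrow>
      b z * cmod (p z) \<le> C"
    and z: "z \<in> G"
  shows "b z * cmod (g z) \<le> 2 * C"
proof -
  have G0: "0 \<in> G" using G(2) z unfolding balanced_def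
    by (metis norm_zero zero_le_one vector_smult_lzero)
  \<comment> \<open>Taylor coefficients of the slice through \<open>z\<close>, that is, the
    homogeneous terms of \<open>g\<close> at 0; \<open>p r n\<close> is then a Taylor polynomial of
    the dilation of \<open>g\<close> by \<open>r\<close>.\<close>
  define c where "c z k = (deriv ^^ k) (\<lambda>t. g (t *s z)) 0 / fact k" for z k
  define p where "p r n z = (\<Sum>k<n. c z k * of_real r ^ k)" for r :: real and n z
  have p_poly: "polynomial_fun (p r n)" for r n
  proof -
    have "polynomial_fun (\<lambda>z. \<Sum>k<n. (of_real r ^ k / fact k) * (deriv ^^ k) (\<lambda>t. g (t *s z)) 0)"
      by (intro polynomial_fun_sum polynomial_fun_cmult polynomial_fun_radial_derivative[OF G(1) G0 g])
         simp
    then show ?thesis by (simp add: p_def[abs_def] c_def mult.commute)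
  qed
  \<comment> \<open>Radiality makes the bound constant along the circle through \<open>w\<close>, as
    Cauchy's inequality and the maximum principle require.\<close>
  have circle: "cmod (g (t *s w)) \<le> 1 / u w" if "w \<in> G" "cmod t = 1" for w t
  proof -
    have "t *s w \<in> G" using G(2) that by (simp add: balanced_def)
    from ug[OF this] show ?thesis
      using u that by (simp add: radial_on_def pos_le_divide_eq mult.commute)
  qed
  have cball_hol: "(\<lambda>t. g (t *s w)) holomorphic_on cball 0 1" if w: "w \<in> G" for w
  proof -
    obtain R where "1 < R" "(\<lambda>t. g (t *s w)) holomorphic_on ball 0 R"
      using balanced_slice_holomorphic[OF G g w] .
    then show ?thesis by (auto elim!: holomorphic_on_subset)
  qed
  have c_bd: "cmod (c w k) \<le> 1 / u w" if w: "w \<in> G" for w k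
  proof -
    have "cmod ((deriv ^^ k) (\<lambda>t. g (t *s w)) 0) \<le> fact k * (1 / u w) / 1 ^ k"
      by (rule Cauchy_inequality)
         (use cball_hol[OF w] circle[OF w] in
           \<open>auto intro: holomorphic_on_subset holomorphic_on_imp_continuous_on\<close>)
    then show ?thesis by (simp add: c_def norm_divide field_simps)
  qed
  have sums: "(\<lambda>k. c w k * of_real r ^ k) sums g (of_real r *s w)"
    if w: "w \<in> G" and r: "0 \<le> r" "r < 1" for w r
  proof -
    obtain R where R: "1 < R" "(\<lambda>t. g (t *s w)) holomorphic_on ball 0 R"
      using balanced_slice_holomorphic[OF G g w] .
    have "(\<lambda>k. (deriv ^^ k) (\<lambda>t. g (t *s w)) 0 / fact k * (of_real r - 0) ^ k)
        sums g (of_real r *s w)"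
      by (rule holomorphic_power_series[OF R(2)]) (use R r in simp)
    then show ?thesis by (simp add: c_def)
  qed
  have dilation: "b z * cmod (g (of_real r *s z)) \<le> 2 * C" if r: "0 \<le> r" "r < 1" for r
  proof -
    have "(\<lambda>n. r ^ n / (1 - r)) \<longlonglongrightarrow> 0 / (1 - r)"
      using r by (intro tendsto_intros LIMSEQ_realpow_zero) auto
    then have "\<forall>\<^sub>F n in sequentially. r ^ n / (1 - r) < 1"
      by (rule order_tendstoD) simp
    then obtain n0 where n0: "\<And>n. n \<ge> n0 \<Longrightarrow> r ^ n / (1 - r) < 1"
      by (auto simp: eventually_sequentially)
    \<comment> \<open>The dilation contributes at most \<open>1 / u w\<close> and, for
      \<open>n \<ge> n0\<close>, the tail at most as much again. The choice of \<open>n0\<close>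
      depends on \<open>r\<close> only.\<close>
    have p_bd: "u w * cmod (p r n w) \<le> 2" if n: "n \<ge> n0" and w: "w \<in> G" for n w
    proof -
      have "cmod (g (of_real r *s w)) \<le> 1 / u w"
        by (rule maximum_modulus_frontier[where S = "cball 0 1" and f = "\<lambda>t. g (t *s w)"])
           (use cball_hol[OF w] circle[OF w] r in
             \<open>auto intro: holomorphic_on_subset holomorphic_on_imp_continuous_on\<close>)
      moreover have "cmod (g (of_real r *s w) - p r n w) \<le> 1 / u w * (r ^ n / (1 - r))"
        unfolding p_def
        by (rule power_series_partial_sum_bound[OF c_bd[OF w] r sums[OF w r]])
      moreover have "1 / u w * (r ^ n / (1 - r)) \<le> 1 / u w * 1"
        using n0[OF n] u(1)[OF w] by (intro mult_left_mono) auto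
      moreover have "cmod (p r n w) \<le> cmod (g (of_real r *s w)) + cmod (g (of_real r *s w) - p r n w)"
        by (metis norm_triangle_sub norm_minus_commute)
      ultimately have "cmod (p r n w) \<le> 2 / u w" by simp
      then show ?thesis using u(1)[OF w] by (simp add: pos_le_divide_eq mult.commute)
    qed
    show ?thesis
    proof (rule Lim_bounded)
      show "(\<lambda>n. b z * cmod (p r n z)) \<longlonglongrightarrow> b z * cmod (g (of_real r *s z))"
        unfolding p_def using sums[OF z r] by (intro tendsto_intros) (simp add: sums_def)
      show "\<forall>n\<ge>n0. b z * cmod (p r n z) \<le> 2 * C"
      proof (intro allI impI)
        fix n assume n: "n0 \<le> n"
        \<comment> \<open>Half of the polynomial lies in the unit ball, so the hypothesis on
          polynomials applies to it.\<close>
        have "b z * cmod ((1 / 2) * p r n z) \<le> C"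
          by (rule poly[OF polynomial_fun_cmult[OF p_poly]])
             (use p_bd[OF n] z in \<open>auto simp: norm_divide\<close>)
        then show "b z * cmod (p r n z) \<le> 2 * C" by (simp add: norm_mult)
      qed
    qed
  qed
  define r where "r n = 1 - 1 / real (Suc n)" for n
  have r: "0 \<le> r n" "r n < 1" for n by (auto simp: r_def)
  have "r \<longlonglongrightarrow> 1 - 0"
    unfolding r_def[abs_def] by (intro tendsto_diff tendsto_const LIMSEQ_Suc lim_const_over_n)
  then have "(\<lambda>n. of_real (r n) :: complex) \<longlonglongrightarrow> 1"
    using tendsto_of_real[of r 1 sequentially, where ?'a = complex] by simp
  moreover have "isCont (\<lambda>t. g (t *s z)) 1"
    using hol_on_slice_deriv[OF g, of 0 1 z] z by (simp add: DERIV_isCont)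
  ultimately have "(\<lambda>n. g (of_real (r n) *s z)) \<longlonglongrightarrow> g (1 *s z)"
    using isCont_tendsto_compose by blast
  then have "(\<lambda>n. b z * cmod (g (of_real (r n) *s z))) \<longlonglongrightarrow> b z * cmod (g z)"
    by (intro tendsto_intros) simp
  then show ?thesis
    by (rule Lim_bounded[where M = 0]) (use dilation r in auto)
qed

text \<open>The gliding hump: each new summand is large at some point, and so small at the points chosen
  before that it does not spoil the earlier humps.\<close>

lemma gliding_hump:
  fixes w b :: "nat \<Rightarrow> complex ^ 'd \<Rightarrow> real"
  assumes G: "open G"
    and w: "\<And>N. weight_on G (w N)" and b: "\<And>k z. z \<in> G \<Longrightarrow> 0 < b k z"
    and p_hol: "\<And>p. polynomial_fun p \<Longrightarrow> hol_on p G"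
    and w_bdd: "\<And>p N. polynomial_fun p \<Longrightarrow> bdd_above ((\<lambda>z. w N z * cmod (p z)) ` G)"
    and b_bdd: "\<And>p k. polynomial_fun p \<Longrightarrow> bdd_above ((\<lambda>z. b k z * cmod (p z)) ` G)"
    and hump: "\<And>k c. \<exists>p z. polynomial_fun p \<and> z \<in> G \<and> (\<forall>x\<in>G. \<forall>N\<le>k. w N x * cmod (p x) \<le> 1)
        \<and> c < b k z * cmod (p z)"
  obtains f where "\<And>N. f \<in> Ha G (w N)" "\<And>k. \<exists>z\<in>G. real k < b k z * cmod (f z)"
proof -
  have w_pos: "0 < w N x" if "x \<in> G" for N x using w that by (simp add: weight_on_def)
  \<comment> \<open>A state holds the current polynomial, the point of its hump and a tolerance. The
    last clause makes an error of size \<delta> in the weight \<open>w 0\<close>, measured without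
    it at most \<open>w 0 z\<close>, harmless for \<open>b k\<close> at \<open>z\<close>.\<close>
  define P where "P k s \<longleftrightarrow> (case s of (q, z, \<delta>) \<Rightarrow> polynomial_fun q \<and> z \<in> G \<and> 0 < \<delta> \<and> \<delta> \<le> 1 \<and>
      real k + 1 < b k z * cmod (q z) \<and> \<delta> * b k z \<le> w 0 z)"
    for k and s :: "(complex ^ 'd \<Rightarrow> complex) \<times> (complex ^ 'd) \<times> real"
  \<comment> \<open>The new increment is small for the first weights only; as \<open>k\<close>
    grows, every weight is eventually included.\<close>
  define Q where "Q k s s' \<longleftrightarrow> (case s of (q, z, \<delta>) \<Rightarrow> case s' of (q', z', \<delta>') \<Rightarrow>
      \<delta>' \<le> \<delta> \<and> (\<forall>x\<in>G. \<forall>N\<le>k. w N x * cmod (q' x - q x) \<le> \<delta> / 2 ^ Suc k))"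
    for k and s s' :: "(complex ^ 'd \<Rightarrow> complex) \<times> (complex ^ 'd) \<times> real"
  have step: "\<exists>q' z' \<delta>'. P k (q', z', \<delta>') \<and> \<delta>' \<le> \<delta> \<and>
      (\<forall>x\<in>G. \<forall>N\<le>k. w N x * cmod (q' x - q x) \<le> \<delta> / 2 ^ k)"
    if q: "polynomial_fun q" and \<delta>: "0 < \<delta>" "\<delta> \<le> 1" for k q and \<delta> :: real
  proof -
    obtain C where C: "\<And>x. x \<in> G \<Longrightarrow> b k x * cmod (q x) \<le> C"
      using b_bdd[OF q, of k] by (auto simp: bdd_above_def)
    define \<eta> where "\<eta> = \<delta> / 2 ^ k"
    have \<eta>: "0 < \<eta>" using \<delta> by (simp add: \<eta>_def)
    obtain p z where p: "polynomial_fun p" and z: "z \<in> G"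
      and small: "\<And>x N. x \<in> G \<Longrightarrow> N \<le> k \<Longrightarrow> w N x * cmod (p x) \<le> 1"
      \<comment> \<open>Dividing by \<eta> compensates for the later scaling of \<open>p\<close>,
        and \<open>C\<close> absorbs the value of the previous polynomial at the new point.\<close>
      and large: "(real k + 1 + C) / \<eta> < b k z * cmod (p z)"
      using hump[of k "(real k + 1 + C) / \<eta>"] by blast
    define q' where "q' x = q x + of_real \<eta> * p x" for x
    define \<delta>' where "\<delta>' = min \<delta> (w 0 z / b k z)"
    have "real k + 1 + C < b k z * cmod (of_real \<eta> * p z)"
      using large \<eta> by (simp add: norm_mult pos_divide_less_eq ac_simps)
    moreover have "b k z * cmod (of_real \<eta> * p z) \<le> b k z * (cmod (q' z) + cmod (q z))"
      using b[OF z, of k] norm_triangle_ineq4[of "q' z" "q z"]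
      by (intro mult_left_mono) (auto simp: q'_def)
    ultimately have "real k + 1 < b k z * cmod (q' z)"
      using C[OF z] by (simp add: distrib_left)
    moreover have "polynomial_fun q'"
      unfolding q'_def[abs_def] by (intro polynomial_fun_add polynomial_fun_cmult p q)
    moreover have "\<delta>' * b k z \<le> w 0 z"
      using b[OF z, of k] by (simp add: \<delta>'_def pos_le_divide_eq[symmetric])
    moreover have "0 < \<delta>'" using b[OF z, of k] w_pos[OF z] \<delta> by (simp add: \<delta>'_def)
    moreover have "w N x * cmod (q' x - q x) \<le> \<delta> / 2 ^ k" if "x \<in> G" "N \<le> k" for x N
    proof -
      have "w N x * cmod (q' x - q x) = \<eta> * (w N x * cmod (p x))"
        using \<eta> by (simp add: q'_def norm_mult ac_simps)
      also have "\<dots> \<le> \<eta> * 1" using small[OF that] \<eta> by (intro mult_left_mono) auto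
      finally show ?thesis by (simp add: \<eta>_def)
    qed
    moreover have "\<delta>' \<le> \<delta>" by (simp add: \<delta>'_def)
    ultimately show ?thesis
      using z \<delta>(2) by (intro exI[of _ q'] exI[of _ z] exI[of _ \<delta>']) (auto simp: P_def)
  qed
  have "\<exists>s. \<forall>k. P k (s k) \<and> Q k (s k) (s (Suc k))"
  proof (rule dependent_nat_choice)
    show "\<exists>x. P 0 x"
      using step[OF polynomial_fun_const[of 0], of 1 0] by auto
    fix x k assume "P k x"
    then obtain q z \<delta> where x: "x = (q, z, \<delta>)" "polynomial_fun q" "0 < \<delta>" "\<delta> \<le> 1"
      by (cases x) (auto simp: P_def)
    show "\<exists>y. P (Suc k) y \<and> Q k x y"
      using step[OF x(2-4), of "Suc k"] by (force simp: Q_def x(1))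
  qed
  then obtain s where s: "\<And>k. P k (s k)" "\<And>k. Q k (s k) (s (Suc k))" by blast
  define q where "q k = fst (s k)" for k
  define \<zeta> where "\<zeta> k = fst (snd (s k))" for k
  define \<delta> where "\<delta> k = snd (snd (s k))" for k
  have s_eq: "s k = (q k, \<zeta> k, \<delta> k)" for k by (simp add: q_def \<zeta>_def \<delta>_def)
  have q: "polynomial_fun (q k)" and \<zeta>: "\<zeta> k \<in> G" and \<delta>: "0 < \<delta> k" "\<delta> k \<le> 1"
    and q_large: "real k + 1 < b k (\<zeta> k) * cmod (q k (\<zeta> k))"
    and \<delta>b: "\<delta> k * b k (\<zeta> k) \<le> w 0 (\<zeta> k)" for k
    using s(1)[of k] by (auto simp: P_def s_eq)
  have \<delta>_dec: "\<delta> (Suc k) \<le> \<delta> k"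
    and q_diff: "x \<in> G \<Longrightarrow> N \<le> k \<Longrightarrow> w N x * cmod (q (Suc k) x - q k x) \<le> \<delta> k / 2 ^ Suc k"
    for k x N
    using s(2)[of k] by (auto simp: Q_def s_eq)
  \<comment> \<open>The bound is a partial sum of the geometric series in closed form, so that the
    induction telescopes; the monotonicity of \<delta> is carried along.\<close>
  have tail: "\<delta> (k + j) \<le> \<delta> k \<and> w N x * cmod (q (k + j) x - q k x) \<le> \<delta> k * (1 / 2 ^ k - 1 / 2 ^ (k + j))"
    if x: "x \<in> G" and N: "N \<le> k" for x N k j
  proof (induction j)
    case 0
    show ?case by simp
  next
    case (Suc j)
    have "w N x * cmod (q (k + Suc j) x - q k x)
        \<le> w N x * (cmod (q (Suc (k + j)) x - q (k + j) x) + cmod (q (k + j) x - q k x))"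
      using norm_triangle_ineq[of "q (Suc (k + j)) x - q (k + j) x" "q (k + j) x - q k x"]
        w_pos[OF x, of N] by (intro mult_left_mono) auto
    also have "\<dots> \<le> \<delta> (k + j) / 2 ^ Suc (k + j) + \<delta> k * (1 / 2 ^ k - 1 / 2 ^ (k + j))"
      unfolding distrib_left using q_diff[OF x, of N "k + j"] N Suc by (intro add_mono) auto
    also have "\<delta> (k + j) / 2 ^ Suc (k + j) \<le> \<delta> k * (1 / 2 ^ Suc (k + j))"
      using Suc by (simp add: divide_right_mono)
    also have "\<delta> k * (1 / 2 ^ Suc (k + j)) + \<delta> k * (1 / 2 ^ k - 1 / 2 ^ (k + j)) =
        \<delta> k * (1 / 2 ^ k - 1 / 2 ^ (k + Suc j))"
      by (simp add: field_simps)
    finally show ?case using Suc \<delta>_dec[of "k + j"] by simp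
  qed
  have tail': "w N x * cmod (q j x - q k x) \<le> \<delta> k / 2 ^ k"
    if "x \<in> G" "N \<le> k" "k \<le> j" for x N k j
  proof -
    have "w N x * cmod (q j x - q k x) \<le> \<delta> k * (1 / 2 ^ k - 1 / 2 ^ j)"
      using tail[OF that(1,2), of "j - k"] that(3) by simp
    also have "\<dots> \<le> \<delta> k * (1 / 2 ^ k)"
      using \<delta>(1)[of k] by (intro mult_left_mono) auto
    finally show ?thesis by simp
  qed
  define f where "f x = lim (\<lambda>n. q n x)" for x
  have half: "(\<lambda>k. 1 / 2 ^ k :: real) \<longlonglongrightarrow> 0"
    using LIMSEQ_realpow_zero[of "1 / 2"] by (simp add: power_one_over)
  have lim: "(\<lambda>n. q n x) \<longlonglongrightarrow> f x" if x: "x \<in> G" for x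
  proof -
    have "Cauchy (\<lambda>n. q n x)"
    proof (rule CauchyI')
      fix e :: real assume e: "0 < e"
      have "0 < e * w 0 x" using e w_pos[OF x] by simp
      with half have "\<forall>\<^sub>F k in sequentially. 1 / 2 ^ k < e * w 0 x"
        by (rule order_tendstoD)
      then obtain k0 where k0: "\<And>k. k \<ge> k0 \<Longrightarrow> 1 / 2 ^ k < e * w 0 x"
        by (auto simp: eventually_sequentially)
      have "cmod (q m x - q n x) < e" if "m \<ge> k0" "n > m" for m n
      proof -
        have "w 0 x * cmod (q n x - q m x) \<le> \<delta> m / 2 ^ m" using that by (intro tail' x) auto
        also have "\<dots> \<le> 1 / 2 ^ m" using \<delta>[of m] by (simp add: divide_right_mono)
        also have "\<dots> < e * w 0 x" using k0 that by simp
        finally show ?thesis using w_pos[OF x, of 0] by (simp add: norm_minus_commute mult.commute)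
      qed
      then show "\<exists>M. \<forall>m\<ge>M. \<forall>n>m. dist (q m x) (q n x) < e"
        unfolding dist_norm by blast
    qed
    then show ?thesis
      by (simp add: f_def Cauchy_convergent convergent_LIMSEQ_iff[symmetric])
  qed
  have f_diff: "w N x * cmod (f x - q k x) \<le> \<delta> k / 2 ^ k" if x: "x \<in> G" and "N \<le> k" for x N k
  proof (rule Lim_bounded)
    show "(\<lambda>j. w N x * cmod (q j x - q k x)) \<longlonglongrightarrow> w N x * cmod (f x - q k x)"
      by (intro tendsto_intros lim x)
    show "\<forall>j\<ge>k. w N x * cmod (q j x - q k x) \<le> \<delta> k / 2 ^ k"
      using tail' that by blast
  qed
  have f_hol: "hol_on f G"
  proof (rule hol_on_UN)
    fix z assume z: "z \<in> G"
    obtain r where r: "0 < r" "cball z r \<subseteq> G" using G z open_contains_cball by blast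
    have "continuous_on (cball z r) (w 0)"
      using w[of 0] r(2) by (auto simp: weight_on_def intro: continuous_on_subset)
    \<comment> \<open>A positive minimum of \<open>w 0\<close> on the ball converts weighted
      convergence into uniform convergence.\<close>
    then obtain x0 where x0: "x0 \<in> cball z r" "\<And>x. x \<in> cball z r \<Longrightarrow> w 0 x0 \<le> w 0 x"
      using continuous_attains_inf[of "cball z r" "w 0"] r(1) by auto
    have w0: "0 < w 0 x0" using w_pos x0(1) r(2) by auto
    have "hol_on (q k) (ball z r)" for k
      using r(2) by (intro hol_on_subset[OF p_hol[OF q]]) auto
    moreover have "uniform_limit (ball z r) q f sequentially"
    proof (rule uniform_limitI)
      fix e :: real assume "0 < e"
      with w0 have "0 < e * w 0 x0" by simp
      with half have "\<forall>\<^sub>F k in sequentially. 1 / 2 ^ k < e * w 0 x0"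
        by (rule order_tendstoD)
      then show "\<forall>\<^sub>F k in sequentially. \<forall>x\<in>ball z r. dist (q k x) (f x) < e"
      proof (rule eventually_mono, intro ballI)
        fix k x assume k: "1 / 2 ^ k < e * w 0 x0" and x: "x \<in> ball z r"
        have xG: "x \<in> G" and "w 0 x0 \<le> w 0 x" using x r(2) x0(2) by auto
        then have "w 0 x0 * cmod (f x - q k x) \<le> w 0 x * cmod (f x - q k x)"
          by (intro mult_right_mono) auto
        also have "\<dots> \<le> \<delta> k / 2 ^ k" using f_diff[OF xG] by simp
        also have "\<dots> \<le> 1 / 2 ^ k" using \<delta>[of k] by (simp add: divide_right_mono)
        also have "\<dots> < e * w 0 x0" by (rule k)
        finally show "dist (q k x) (f x) < e"
          using w0 by (simp add: dist_norm norm_minus_commute mult.commute)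
      qed
    qed
    ultimately have "hol_on f (ball z r)"
      by (rule hol_on_uniform_limit[OF open_ball])
    then show "\<exists>S. z \<in> S \<and> hol_on f S" using r(1) by (intro exI[of _ "ball z r"]) auto
  qed
  show ?thesis
  proof
    fix N
    obtain C where C: "\<And>x. x \<in> G \<Longrightarrow> w N x * cmod (q N x) \<le> C"
      using w_bdd[OF q[of N], of N] by (auto simp: bdd_above_def)
    have "w N x * cmod (f x) \<le> C + 1" if x: "x \<in> G" for x
    proof -
      have "w N x * cmod (f x) \<le> w N x * (cmod (q N x) + cmod (f x - q N x))"
        using w_pos[OF x, of N] norm_triangle_sub[of "f x" "q N x"] by (intro mult_left_mono) auto
      moreover have "\<delta> N / 2 ^ N \<le> 1"
        using \<delta>[of N] frac_le[of 1 "\<delta> N" 1 "2 ^ N"] by simp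
      ultimately show ?thesis
        using C[OF x] f_diff[OF x, of N N] unfolding distrib_left by linarith
    qed
    with f_hol show "f \<in> Ha G (w N)" by (auto simp: Ha_def intro!: bdd_aboveI[of _ "C + 1"])
  next
    fix k
    define z where "z = \<zeta> k"
    have z: "z \<in> G" by (simp add: z_def \<zeta>)
    \<comment> \<open>By the choice of the tolerance, all later increments together change the hump
      by at most 1, which lowers \<open>k + 1\<close> to \<open>k\<close>.\<close>
    have "w 0 z * cmod (f z - q k z) \<le> \<delta> k / 2 ^ k" using f_diff[OF z] by simp
    also have "\<dots> \<le> \<delta> k" using \<delta>[of k] by (simp add: divide_le_eq)
    finally have "\<delta> k * (b k z * cmod (f z - q k z)) \<le> \<delta> k * 1"
      using mult_right_mono[OF \<delta>b[of k], of "cmod (f z - q k z)"] by (simp add: z_def mult.assoc)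
    then have "b k z * cmod (f z - q k z) \<le> 1" using \<delta>(1)[of k] by simp
    moreover have "b k z * cmod (q k z) \<le> b k z * (cmod (f z) + cmod (f z - q k z))"
      using b[OF z, of k] norm_triangle_sub[of "q k z" "f z"]
      by (intro mult_left_mono) (auto simp: norm_minus_commute)
    ultimately have "real k < b k z * cmod (f z)"
      using q_large[of k] by (simp add: distrib_left z_def)
    with z show "\<exists>z\<in>G. real k < b k z * cmod (f z)" by blast
  qed
qed

section \<open>Associated weights\<close>

text \<open>Outside a compact set the weighted modulus is below 1, and on that set it is bounded by
  continuity.\<close>

lemma Ha0_subset_Ha:
  assumes "weight_on G a"
  shows "Ha0 G a \<subseteq> Ha G a"
proof
  fix f assume f: "f \<in> Ha0 G a"
  then have hol: "hol_on f G" by (simp add: Ha0_def)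
  obtain K where K: "compact K" "K \<subseteq> G" "\<And>z. z \<in> G - K \<Longrightarrow> \<bar>a z * cmod (f z)\<bar> < 1"
    using f by (auto simp: Ha0_def vanishes_at_infinity_on_def dest: spec[of _ 1])
  have "continuous_on K (\<lambda>z. a z * cmod (f z))"
    using assms hol_on_imp_continuous_on[OF hol] K(2)
    by (auto simp: weight_on_def intro!: continuous_intros intro: continuous_on_subset)
  then have "bounded ((\<lambda>z. a z * cmod (f z)) ` K)"
    using K(1) by (intro compact_imp_bounded compact_continuous_image)
  then obtain B where B: "\<And>z. z \<in> K \<Longrightarrow> \<bar>a z * cmod (f z)\<bar> \<le> B"
    by (auto simp: bounded_iff)
  have "a z * cmod (f z) \<le> max B 1" if "z \<in> G" for z
    using B[of z] K(3)[of z] that by (cases "z \<in> K") auto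
  with hol show "f \<in> Ha G a" by (auto simp: Ha_def intro!: bdd_aboveI[of _ "max B 1"])
qed

lemma weight_on_Max:
  assumes "finite I" "I \<noteq> {}" "\<And>i. i \<in> I \<Longrightarrow> weight_on G (a i)"
  shows "weight_on G (\<lambda>w. MAX i\<in>I. a i w)"
  using assms
proof (induction I rule: finite_ne_induct)
  case (insert i I)
  then have "weight_on G (a i)" "weight_on G (\<lambda>w. MAX i\<in>I. a i w)" by auto
  then have "weight_on G (\<lambda>w. max (a i w) (MAX i\<in>I. a i w))"
    by (auto simp: weight_on_def less_max_iff_disj intro!: continuous_on_max)
  then show ?case using insert by simp
qed simp

text \<open>After division by \<open>C\<close> the function competes in the supremum defining
  \<open>assoc_growth\<close>.\<close>

lemma assoc_growth_upper:
  assumes "weight_on G a" "hol_on g G" "\<And>w. w \<in> G \<Longrightarrow> a w * cmod (g w) \<le> C" "0 < C" "z \<in> G"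
  shows "cmod (g z) \<le> C * assoc_growth G a z"
proof -
  let ?S = "{g. hol_on g G \<and> (\<forall>w\<in>G. cmod (g w) \<le> 1 / a w)}"
  have a: "0 < a w" if "w \<in> G" for w using assms(1) that by (simp add: weight_on_def)
  have "cmod (of_real (1 / C) * g w) \<le> 1 / a w" if "w \<in> G" for w
    using assms(3)[OF that] assms(4) a[OF that] by (simp add: norm_mult norm_divide field_simps)
  with assms(2) have "(\<lambda>w. of_real (1 / C) * g w) \<in> ?S" by (blast intro: hol_on_cmult)
  moreover have "bdd_above ((\<lambda>g. cmod (g z)) ` ?S)"
    using assms(5) by (auto intro!: bdd_aboveI[of _ "1 / a z"])
  ultimately have "cmod (of_real (1 / C) * g z) \<le> assoc_growth G a z"
    unfolding assoc_growth_def by (rule cSUP_upper)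
  then show ?thesis using assms(4) by (simp add: norm_mult norm_divide field_simps)
qed

text \<open>States the constraint on competitors as a product, the form of the weighted estimates;
  the zero function supplies the nonemptiness that the real supremum requires.\<close>

lemma assoc_growth_least:
  assumes "weight_on G a" "z \<in> G"
    and "\<And>g. hol_on g G \<Longrightarrow> (\<And>w. w \<in> G \<Longrightarrow> a w * cmod (g w) \<le> 1) \<Longrightarrow> cmod (g z) \<le> B"
  shows "assoc_growth G a z \<le> B"
  unfolding assoc_growth_def
proof (rule cSUP_least)
  have a: "0 < a w" if "w \<in> G" for w using assms(1) that by (simp add: weight_on_def)
  have "hol_on (\<lambda>_. 0) G"
    unfolding hol_on_def by (auto intro!: exI[of _ "\<lambda>_. 0"])
  with a show "{g. hol_on g G \<and> (\<forall>w\<in>G. cmod (g w) \<le> 1 / a w)} \<noteq> {}"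
    by (auto intro!: exI[of _ "\<lambda>_. 0"] less_imp_le)
  show "cmod (g z) \<le> B" if "g \<in> {g. hol_on g G \<and> (\<forall>w\<in>G. cmod (g w) \<le> 1 / a w)}" for g
    using that a by (intro assms(3)) (auto simp: pos_le_divide_eq mult.commute)
qed

lemma assoc_growth_le_inverse: "weight_on G a \<Longrightarrow> z \<in> G \<Longrightarrow> assoc_growth G a z \<le> 1 / a z"
  by (rule assoc_growth_least) (auto simp: weight_on_def pos_le_divide_eq mult.commute)

text \<open>Positivity keeps \<open>assoc_weight\<close> away from division by zero, so that
  inequalities between growths and between associated weights can be exchanged.\<close>

lemma assoc_growth_pos_Max:
  assumes "finite I" "I \<noteq> {}" "\<And>i. i \<in> I \<Longrightarrow> weight_on G (a i)"
    and "\<And>i. i \<in> I \<Longrightarrow> bdd_above (a i ` G)" and "z \<in> G"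
  shows "0 < assoc_growth G (\<lambda>w. MAX i\<in>I. a i w) z"
proof (rule assoc_growth_pos)
  have "\<forall>i\<in>I. \<exists>B. \<forall>w\<in>G. a i w \<le> B" using assms(4) by (auto simp: bdd_above_def)
  then obtain B where B: "\<And>i w. i \<in> I \<Longrightarrow> w \<in> G \<Longrightarrow> a i w \<le> B i" by metis
  have "(MAX i\<in>I. a i w) \<le> (MAX i\<in>I. B i)" if "w \<in> G" for w
  proof (rule Max.boundedI)
    fix y assume "y \<in> (\<lambda>i. a i w) ` I"
    then obtain i where "i \<in> I" "y = a i w" by blast
    then show "y \<le> (MAX i\<in>I. B i)"
      using assms(1) B[OF _ that] by (auto intro: order_trans[OF _ Max_ge])
  qed (use assms(1,2) in auto)
  then show "bdd_above ((\<lambda>w. MAX i\<in>I. a i w) ` G)" by (auto intro!: bdd_aboveI)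
qed (use assms in \<open>auto intro: weight_on_Max\<close>)

section \<open>Algebraic equality and the condition on associated weights\<close>

theorem proposition5p2:
  fixes G :: "(complex ^ 'd) set"
    and a :: "nat \<Rightarrow> nat \<Rightarrow> complex ^ 'd \<Rightarrow> real"
  assumes "open G" and "G \<noteq> {}"
    and "\<And>N n. N \<ge> 1 \<Longrightarrow> n \<ge> 1 \<Longrightarrow> weight_on G (a N n)"
    and "\<And>N n z. N \<ge> 1 \<Longrightarrow> n \<ge> 1 \<Longrightarrow> z \<in> G \<Longrightarrow> a N (Suc n) z \<le> a N n z"
    and "\<And>N n z. N \<ge> 1 \<Longrightarrow> n \<ge> 1 \<Longrightarrow> z \<in> G \<Longrightarrow> a N n z \<le> a (Suc N) n z"
    and "balanced G"
    and "\<And>N n. N \<ge> 1 \<Longrightarrow> n \<ge> 1 \<Longrightarrow> radial_on G (a N n)"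
    and "\<And>N n p. N \<ge> 1 \<Longrightarrow> n \<ge> 1 \<Longrightarrow> polynomial_fun p \<Longrightarrow> p \<in> Ha0 G (a N n)"
  shows "AH G a = VH G a \<longleftrightarrow> condition_B_tilde G a"
proof
  note G = \<open>open G\<close> and balanced = \<open>balanced G\<close>
  note weight = assms(3) and radial = assms(7)
  have pos: "0 < a N n z" if "N \<ge> 1" "n \<ge> 1" "z \<in> G" for N n z
    using weight[OF that(1,2)] that(3) by (simp add: weight_on_def)
  have poly: "p \<in> Ha G (a N n)" if "N \<ge> 1" "n \<ge> 1" "polynomial_fun p" for N n p
    using Ha0_subset_Ha[OF weight[OF that(1,2)]] assms(8)[OF that] by blast
  \<comment> \<open>Membership of the constant 1 in the weighted spaces bounds every weight, as the
    positivity of the associated growths requires.\<close>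
  have a_bdd: "bdd_above (a N n ` G)" if "N \<ge> 1" "n \<ge> 1" for N n
    using poly[OF that polynomial_fun_const[of 1]] by (simp add: Ha_def)
  {
    assume eq: "AH G a = VH G a"
    show "condition_B_tilde G a"
      unfolding condition_B_tilde_def
    proof (intro allI impI)
      fix n :: "nat \<Rightarrow> nat" assume n: "\<forall>N\<ge>1. n N \<ge> 1"
      \<comment> \<open>Domination is stated on unit balls, so that its negation directly supplies a
        small polynomial together with a point where it is large.\<close>
      define R where "R m M L c \<longleftrightarrow> (\<forall>p z. polynomial_fun p \<longrightarrow> z \<in> G \<longrightarrow>
          (\<forall>x\<in>G. \<forall>N\<in>{1..L}. a N (n N) x * cmod (p x) \<le> 1) \<longrightarrow> a M m z * cmod (p z) \<le> c)"
        for m M L c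
      have "\<exists>m\<ge>1. \<forall>M\<ge>1. \<exists>L\<ge>1. \<exists>c>0. R m M L c"
      proof (rule ccontr)
        assume "\<not> ?thesis"
        then have "\<forall>m\<ge>1. \<exists>M\<ge>1. \<forall>L\<ge>1. \<forall>c>0. \<not> R m M L c" by simp
        then obtain M where M: "\<And>m. m \<ge> 1 \<Longrightarrow> M m \<ge> 1"
          and not_R: "\<And>m L c. m \<ge> 1 \<Longrightarrow> L \<ge> 1 \<Longrightarrow> c > 0 \<Longrightarrow> \<not> R m (M m) L c"
          by metis
        \<comment> \<open>an enumeration in which every index occurs infinitely often\<close>
        define \<mu> where "\<mu> k = Suc (fst (prod_decode k))" for k
        have \<mu>: "\<mu> k \<ge> 1" for k by (simp add: \<mu>_def)
        obtain f where f: "\<And>N. f \<in> Ha G (a (Suc N) (n (Suc N)))"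
          and f_large: "\<And>k. \<exists>z\<in>G. real k < a (M (\<mu> k)) (\<mu> k) z * cmod (f z)"
        \<comment> \<open>The hump construction counts its weights from 0 and the double sequence
          from 1, hence \<open>Suc\<close>.\<close>
        proof (rule gliding_hump[where w = "\<lambda>N. a (Suc N) (n (Suc N))"
              and b = "\<lambda>k. a (M (\<mu> k)) (\<mu> k)", OF G])
          show "\<exists>p z. polynomial_fun p \<and> z \<in> G \<and>
              (\<forall>x\<in>G. \<forall>N\<le>k. a (Suc N) (n (Suc N)) x * cmod (p x) \<le> 1) \<and>
              c < a (M (\<mu> k)) (\<mu> k) z * cmod (p z)" for k c
          proof -
            \<comment> \<open>Failure of domination is available for positive constants only, hence
              \<open>max c 1\<close>.\<close>
            obtain p z where "polynomial_fun p" "z \<in> G"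
              "\<forall>x\<in>G. \<forall>N\<in>{1..Suc k}. a N (n N) x * cmod (p x) \<le> 1"
              "max c 1 < a (M (\<mu> k)) (\<mu> k) z * cmod (p z)"
              using not_R[OF \<mu>, of "Suc k" "max c 1" k] by (auto simp: R_def not_le less_max_iff_disj)
            then show ?thesis by (intro exI[of _ p] exI[of _ z]) auto
          qed
        qed (use n weight pos M \<mu> poly poly[of 1 1] in \<open>auto simp: Ha_def\<close>)
        have "f \<in> AH G a"
          unfolding AH_def
        proof (intro INT_I)
          fix N :: nat assume "N \<in> {1..}"
          then have "f \<in> Ha G (a N (n N))" "n N \<in> {1..}"
            using f[of "N - 1"] n by auto
          then show "f \<in> (\<Union>n\<in>{1..}. Ha G (a N n))" by blast
        qed
        with eq obtain m where m: "m \<ge> 1" "\<And>N. N \<ge> 1 \<Longrightarrow> f \<in> Ha G (a N m)"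
          by (auto simp: VH_def)
        from m(2)[OF M[OF m(1)]] obtain C where C: "\<And>z. z \<in> G \<Longrightarrow> a (M m) m z * cmod (f z) \<le> C"
          by (auto simp: Ha_def bdd_above_def)
        \<comment> \<open>The first component selects \<open>m\<close>; the second makes the code at
          least \<open>C\<close>, since a pair's code bounds its second component.\<close>
        define k where "k = prod_encode (m - 1, nat \<lceil>C\<rceil>)"
        have k: "\<mu> k = m" "C \<le> real k"
          using m(1) le_prod_encode_2[of "nat \<lceil>C\<rceil>" "m - 1"] by (auto simp: \<mu>_def k_def)
        show False using f_large[of k] C k by fastforce
      qed
      then obtain m where m: "m \<ge> 1" and bound: "\<And>M. M \<ge> 1 \<Longrightarrow> \<exists>L\<ge>1. \<exists>c>0. R m M L c"
        by blast
      have "\<exists>L\<ge>1. \<exists>c>0. \<forall>z\<in>G. assoc_weight G (a M m) z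
          \<le> c * assoc_weight G (\<lambda>w. MAX N\<in>{1..L}. a N (n N) w) z" if M: "M \<ge> 1" for M
      proof -
        obtain L c where L: "L \<ge> 1" and c: "c > 0" and Lc: "\<And>p z. polynomial_fun p \<Longrightarrow> z \<in> G \<Longrightarrow>
          (\<And>x N. x \<in> G \<Longrightarrow> N \<in> {1..L} \<Longrightarrow> a N (n N) x * cmod (p x) \<le> 1) \<Longrightarrow> a M m z * cmod (p z) \<le> c"
          using bound[OF M] unfolding R_def by blast
        define u where "u w = (MAX N\<in>{1..L}. a N (n N) w)" for w
        have u: "weight_on G u"
          unfolding u_def[abs_def] using L n weight by (intro weight_on_Max) auto
        have u_pos: "0 < u x" if "x \<in> G" for x using u that by (simp add: weight_on_def)
        have u_radial: "radial_on G u"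
          using radial n by (auto simp: radial_on_def u_def intro!: arg_cong[of _ _ Max] image_cong)
        have u_ge: "a N (n N) x \<le> u x" if "N \<in> {1..L}" for N x
          unfolding u_def using that by (intro Max_ge) auto
        have "assoc_weight G (a M m) z \<le> 2 * c * assoc_weight G u z" if z: "z \<in> G" for z
        proof -
          \<comment> \<open>Reciprocals reverse the inequality: up to the factor
            \<open>2 * c\<close>, each competitor for \<open>u\<close> is one for
            \<open>a M m\<close>.\<close>
          have "assoc_growth G u z \<le> 2 * c * assoc_growth G (a M m) z"
          proof (rule assoc_growth_least[OF u z])
            fix g assume g: "hol_on g G" "\<And>w. w \<in> G \<Longrightarrow> u w * cmod (g w) \<le> 1"
            have "a M m w * cmod (g w) \<le> 2 * c" if w: "w \<in> G" for w
            proof (rule weighted_polynomial_bound_extends[OF G balanced g(1) u_pos u_radial g(2)])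
              show "a M m y * cmod (p y) \<le> c"
                if p: "polynomial_fun p" "\<And>x. x \<in> G \<Longrightarrow> u x * cmod (p x) \<le> 1" "y \<in> G" for p y
              proof (rule Lc[OF p(1,3)])
                fix x N assume x: "x \<in> G" and N: "N \<in> {1..L}"
                have "a N (n N) x * cmod (p x) \<le> u x * cmod (p x)"
                  by (intro mult_right_mono u_ge N) auto
                with p(2)[OF x] show "a N (n N) x * cmod (p x) \<le> 1" by simp
              qed
            qed (use w pos[OF M m] in \<open>auto intro: less_imp_le\<close>)
            then show "cmod (g z) \<le> 2 * c * assoc_growth G (a M m) z"
              using weight[OF M m] g(1) c z by (intro assoc_growth_upper) auto
          qed
          moreover have "0 < assoc_growth G u z"
            unfolding u_def[abs_def] using L n weight a_bdd z by (intro assoc_growth_pos_Max) auto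
          moreover have "0 < assoc_growth G (a M m) z"
            using weight a_bdd M m z by (intro assoc_growth_pos) auto
          ultimately show ?thesis by (simp add: assoc_weight_def field_simps)
        qed
        with L c show ?thesis unfolding u_def[abs_def] by (intro exI[of _ L] exI[of _ "2 * c"] conjI ballI) auto
      qed
      with m show "\<exists>m\<ge>1. \<forall>M\<ge>1. \<exists>L\<ge>1. \<exists>c>0. \<forall>z\<in>G. assoc_weight G (a M m) z
          \<le> c * assoc_weight G (\<lambda>w. MAX N\<in>{1..L}. a N (n N) w) z" by blast
    qed
  next
    assume B: "condition_B_tilde G a"
    have "f \<in> VH G a" if "f \<in> AH G a" for f
    proof -
      have "\<forall>N\<ge>1. \<exists>k\<ge>1. f \<in> Ha G (a N k)" using that by (auto simp: AH_def)
      \<comment> \<open>The indices come from \<open>f\<close> itself, which is why the condition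
        quantifies over all sequences.\<close>
      then obtain n where n: "\<And>N. N \<ge> 1 \<Longrightarrow> n N \<ge> 1" "\<And>N. N \<ge> 1 \<Longrightarrow> f \<in> Ha G (a N (n N))"
        by metis
      have hol: "hol_on f G" using n(2)[of 1] by (simp add: Ha_def)
      have "\<forall>N\<ge>1. \<exists>B. \<forall>z\<in>G. a N (n N) z * cmod (f z) \<le> B"
        using n(2) by (auto simp: Ha_def bdd_above_def)
      then obtain C where C: "\<And>N z. N \<ge> 1 \<Longrightarrow> z \<in> G \<Longrightarrow> a N (n N) z * cmod (f z) \<le> C N"
        by metis
      obtain m where m: "m \<ge> 1" and Bm: "\<And>M. M \<ge> 1 \<Longrightarrow> \<exists>L\<ge>1. \<exists>c>0. \<forall>z\<in>G.
          assoc_weight G (a M m) z \<le> c * assoc_weight G (\<lambda>w. MAX N\<in>{1..L}. a N (n N) w) z"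
        using B n(1) unfolding condition_B_tilde_def by blast
      have "f \<in> Ha G (a M m)" if M: "M \<ge> 1" for M
      proof -
        obtain L c where L: "L \<ge> 1" and c: "c > 0" and Lc: "\<And>z. z \<in> G \<Longrightarrow>
          assoc_weight G (a M m) z \<le> c * assoc_weight G (\<lambda>w. MAX N\<in>{1..L}. a N (n N) w) z"
          using Bm[OF M] by blast
        define u where "u w = (MAX N\<in>{1..L}. a N (n N) w)" for w
        have u: "weight_on G u"
          unfolding u_def[abs_def] using L n weight by (intro weight_on_Max) auto
        \<comment> \<open>The value 1 ensures the positivity required by
          \<open>assoc_growth_upper\<close>.\<close>
        define K where "K = max 1 (MAX N\<in>{1..L}. C N)"
        have K: "0 < K" by (simp add: K_def)
        have uf: "u w * cmod (f w) \<le> K" if w: "w \<in> G" for w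
        proof -
          have "u w \<in> (\<lambda>N. a N (n N) w) ` {1..L}"
            unfolding u_def using L by (intro Max_in) auto
          then obtain N where N: "N \<in> {1..L}" "u w = a N (n N) w" by blast
          have "C N \<le> K" unfolding K_def using N(1) by (intro max.coboundedI2 Max_ge) auto
          with C[of N w] N w show ?thesis by simp
        qed
        have "a M m z * cmod (f z) \<le> c * K" if z: "z \<in> G" for z
        proof -
          have pos_u: "0 < assoc_growth G u z"
            unfolding u_def[abs_def] using L n(1) weight a_bdd z by (intro assoc_growth_pos_Max) auto
          have pos_a: "0 < assoc_growth G (a M m) z"
            using weight a_bdd M m z by (intro assoc_growth_pos) auto
          have "a M m z \<le> assoc_weight G (a M m) z"
            using assoc_growth_le_inverse[OF weight[OF M m] z] pos[OF M m z] pos_a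
            by (simp add: assoc_weight_def field_simps)
          also have "\<dots> \<le> c * assoc_weight G u z"
            using Lc[OF z] by (simp add: u_def[abs_def])
          \<comment> \<open>The associated weight of \<open>u\<close> and its growth are reciprocal
            and cancel, leaving a bound independent of \<open>z\<close>.\<close>
          finally have "a M m z * cmod (f z) \<le> c * assoc_weight G u z * (K * assoc_growth G u z)"
            using assoc_growth_upper[OF u hol uf K z] c pos_u
            by (intro mult_mono) (auto simp: assoc_weight_def)
          then show ?thesis using pos_u by (simp add: assoc_weight_def)
        qed
        with hol show ?thesis by (auto simp: Ha_def intro!: bdd_aboveI[of _ "c * K"])
      qed
      with m show ?thesis by (auto simp: VH_def)
    qed
    moreover have "VH G a \<subseteq> AH G a" by (auto simp: AH_def VH_def)
    ultimately show "AH G a = VH G a" by blast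
  }
qed

end
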